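(* Let $D$ be an integral domain, let $V$ be a minimal valuation overring of $D$ and suppose that $\operatorname{Zar}(D)\setminus\{V\}$ is compact. Let $\iota_V:\operatorname{Spec}(V)\to\operatorname{Spec}(D)$, $Q\mapsto Q\cap D$, be the canonical map associated to the inclusion $D\hookrightarrow V$. Then $|\iota_V^{-1}(P)|\leq 2$ for every $P\in\operatorname{Spec}(D)$; in particular, $\dim(V)\leq 2\dim(D)$.
   Context: For an integral domain $D$ with quotient field $K$, $\operatorname{Zar}(D)$ is the set of all valuation rings $V$ with $D\subseteq V\subseteq K$ and quotient field $K$ (including $K$ itself), called valuation overrings of $D$. It carries the Zariski topology, having as a subbasis of open sets the sets $\{V\in\operatorname{Zar}(D)\mid x_1,\ldots,x_n\in V\}$ for finite subsets $\{x_1,\ldots,x_n\}\subseteq K$. A minimal valuation overring is a minimal element of $\operatorname{Zar}(D)$ with respect to inclusion. "Compact" means that every open cover has a finite subcover (no Hausdorff condition). $\dim$ denotes Krull dimension (possibly $\infty$). *)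

theory Defs
  imports
    "HOL-Algebra.Subrings"
    "HOL-Analysis.Function_Topology"
    "HOL-Library.Extended_Nat"
begin

(* Integral domains are handled as subdomains R of an ambient field K; R viewed as a ring
   of its own is the record K\<lparr>carrier := R\<rparr>. *)

definition quotient_field :: "('a, 'm) ring_scheme \<Rightarrow> 'a set \<Rightarrow> bool" where
  "quotient_field K R \<longleftrightarrow> field K \<and> subdomain R K \<and>
     (\<forall>x\<in>carrier K. \<exists>a\<in>R. \<exists>b\<in>R - {\<zero>\<^bsub>K\<^esub>}. x = a \<otimes>\<^bsub>K\<^esub> inv\<^bsub>K\<^esub> b)"

definition valuation_ring_of :: "('a, 'm) ring_scheme \<Rightarrow> 'a set \<Rightarrow> bool" where
  "valuation_ring_of K V \<longleftrightarrow> quotient_field K V \<and>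
     (\<forall>x\<in>carrier K - {\<zero>\<^bsub>K\<^esub>}. x \<in> V \<or> inv\<^bsub>K\<^esub> x \<in> V)"

definition Zar :: "('a, 'm) ring_scheme \<Rightarrow> 'a set \<Rightarrow> 'a set set" where
  "Zar K D = {V. valuation_ring_of K V \<and> D \<subseteq> V}"

(* The point set is all of Zar K D, since F = {} contributes Zar K D to the subbasis. *)
definition zariski_topology :: "('a, 'm) ring_scheme \<Rightarrow> 'a set \<Rightarrow> 'a set topology" where
  "zariski_topology K D =
     topology_generated_by {{V \<in> Zar K D. F \<subseteq> V} | F. finite F \<and> F \<subseteq> carrier K}"

definition minimal_valuation_overring :: "('a, 'm) ring_scheme \<Rightarrow> 'a set \<Rightarrow> 'a set \<Rightarrow> bool" where
  "minimal_valuation_overring K D V \<longleftrightarrow>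
     V \<in> Zar K D \<and> (\<forall>W\<in>Zar K D. W \<subseteq> V \<longrightarrow> W = V)"

definition Spec :: "('a, 'm) ring_scheme \<Rightarrow> 'a set set" where
  "Spec R = {P. primeideal P R}"

(* The map Spec(V) \<rightarrow> Spec(D) for D a subring of V; to be used on Spec (K\<lparr>carrier := V\<rparr>) only. *)
definition contraction :: "'a set \<Rightarrow> 'a set \<Rightarrow> 'a set" where
  "contraction D Q = Q \<inter> D"

(* A chain of n + 1 primes P 0 \<subset> ... \<subset> P n has length n. For the zero ring this gives 0. *)
definition krull_dim :: "('a, 'm) ring_scheme \<Rightarrow> enat" where
  "krull_dim R = Sup {enat n | n. \<exists>P :: nat \<Rightarrow> 'a set.
     (\<forall>i\<le>n. P i \<in> Spec R) \<and> (\<forall>i<n. P i \<subset> P (Suc i))}"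

end

theory Submission
  imports Defs
begin

text \<open>
  A valuation overring \<open>W\<close> other than \<open>V\<close> is not contained in \<open>V\<close>, because \<open>V\<close> is minimal. So the
  open sets \<open>{W. x \<in> W}\<close> with \<open>x \<notin> V\<close> cover \<open>Zar(D) - {V}\<close>, and by compactness finitely many of
  them do: there is a finite set \<open>X\<close> outside \<open>V\<close> such that \<open>V\<close> is the only valuation overring
  disjoint from \<open>X\<close> (\<open>finite_separating_set\<close>). Put differently, \<open>V\<close> is the only valuation overring
  in which the finitely many inverses of elements of \<open>X\<close> are nonunits.

  Such uniqueness is an integrality statement. If \<open>A\<close> is a ring between \<open>D\<close> and \<open>V\<close> that contains
  these inverses, and \<open>z \<in> V\<close> is nonzero, then no valuation ring contains \<open>A[1/z]\<close> and has \<open>1/z\<close>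
  and all the elements of \<open>A\<close> that are nonunits of \<open>V\<close> among its nonunits. By Chevalley's extension
  theorem the ideal of \<open>A[1/z]\<close> generated by these elements is the whole ring, and this is an
  equation for \<open>z\<close> over \<open>A\<close> whose leading coefficient is a unit of \<open>V\<close>
  (\<open>unit_leading_coefficient\<close>). So \<open>V\<close> is integral over the localisation of \<open>A\<close> at its centre, and
  distinct comparable primes of \<open>V\<close> have distinct contractions to \<open>A\<close> (\<open>incomparability\<close>).

  Suppose now that three primes \<open>Q0 \<subset> Q1 \<subset> Q2\<close> of \<open>V\<close> lie over one prime \<open>P\<close> of \<open>D\<close>. Let \<open>A\<close> be the
  intersection of \<open>V\<close> with the ring generated over \<open>D\<^sub>P\<close> by the inverses of \<open>X\<close>. Choose
  \<open>b \<in> A \<inter> Q2 - Q1\<close>, let \<open>N\<close> be the radical of \<open>bV\<close>, which is a prime between \<open>Q1\<close> and \<open>Q2\<close>, and let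
  \<open>B\<close> be the localisation of \<open>A\<close> at \<open>N \<inter> A\<close>. Integrality shows that the maximal ideal of \<open>B\<close> is the
  radical of \<open>bB\<close>. Modulo \<open>P\<close>, the ring \<open>B\<close> is a localisation of an algebra of finite type over the
  field \<open>D\<^sub>P / P D\<^sub>P\<close>, hence Noetherian. Krull's principal ideal theorem then forbids
  two distinct comparable primes of \<open>B\<close> over \<open>P\<close> that do not contain \<open>b\<close>; but \<open>Q0\<close> and \<open>Q1\<close>
  induce such primes (\<open>no_three_primes_over\<close>).

  For the dimension, every second prime of a chain in \<open>V\<close> has a strictly larger contraction. That alone
  would allow \<open>dim V = 2 dim D + 1\<close>, but over the zero ideal of \<open>D\<close> there is only the zero ideal of
  \<open>V\<close>, since \<open>K\<close> is the quotient field of \<open>D\<close>, and this removes the extra step.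
\<close>

section \<open>Noetherian rings modulo an ideal and the principal ideal theorem\<close>

(* Leaves <+> to the sum of ideals. *)
no_notation Sum_Type.Plus (infixr "<+>" 65)

text \<open>
  The quotient of \<open>R\<close> by the ideal generated by \<open>T\<close> is Noetherian. The ring \<open>D\<close> may fail to be
  Noetherian while \<open>D\<^sub>P / P D\<^sub>P\<close> is a field. In this form no quotient has to be taken, and all rings
  remain subrings of one field. The maximum condition is chosen instead of
  finite generation because it transfers along any monotone map of ideals that is injective on
  comparable pairs.
\<close>

definition noetherian_above :: "('a, 'm) ring_scheme \<Rightarrow> 'a set \<Rightarrow> bool" where
  "noetherian_above R T \<longleftrightarrow>
     (\<forall>\<J>. \<J> \<noteq> {} \<longrightarrow> (\<forall>J\<in>\<J>. ideal J R \<and> T \<subseteq> J) \<longrightarrow>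
        (\<exists>M\<in>\<J>. \<forall>J\<in>\<J>. M \<subseteq> J \<longrightarrow> J = M))"

lemma noetherian_aboveE:
  assumes "noetherian_above R T" and "J\<^sub>0 \<in> \<J>"
    and "\<And>J. J \<in> \<J> \<Longrightarrow> ideal J R" and "\<And>J. J \<in> \<J> \<Longrightarrow> T \<subseteq> J"
  obtains M where "M \<in> \<J>" and "\<And>J. J \<in> \<J> \<Longrightarrow> M \<subseteq> J \<Longrightarrow> J = M"
proof -
  have "\<exists>M\<in>\<J>. \<forall>J\<in>\<J>. M \<subseteq> J \<longrightarrow> J = M"
    using assms(1)[unfolded noetherian_above_def, rule_format, of \<J>] assms(2-4) by blast
  then show thesis
    using that by blast
qed

lemma noetherian_above_mono:
  "noetherian_above R T \<Longrightarrow> T \<subseteq> T' \<Longrightarrow> noetherian_above R T'"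
  unfolding noetherian_above_def by (meson order_trans)

context cring
begin

text \<open>
  Closure under additive inverses follows from multiplication by \<open>\<ominus> \<one>\<close>.
\<close>

lemma idealI_cring:
  assumes "J \<subseteq> carrier R" and "\<zero> \<in> J"
    and "\<And>x y. x \<in> J \<Longrightarrow> y \<in> J \<Longrightarrow> x \<oplus> y \<in> J"
    and "\<And>r x. r \<in> carrier R \<Longrightarrow> x \<in> J \<Longrightarrow> r \<otimes> x \<in> J"
  shows "ideal J R"
proof (rule idealI)
  show "ring R" by (rule ring_axioms)
  show "subgroup J (add_monoid R)"
  proof (rule add.subgroupI)
    fix x assume x: "x \<in> J"
    then have "\<ominus> \<one> \<otimes> x \<in> J" using assms(4) by simp
    moreover have "\<ominus> \<one> \<otimes> x = \<ominus> x" using x assms(1) by (auto simp: l_minus)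
    ultimately show "\<ominus> x \<in> J" by simp
  qed (use assms in auto)
next
  fix a x assume ax: "a \<in> J" "x \<in> carrier R"
  then show "x \<otimes> a \<in> J" using assms(4) by simp
  moreover have "a \<otimes> x = x \<otimes> a" using ax assms(1) m_comm by blast
  ultimately show "a \<otimes> x \<in> J" by simp
qed

lemma in_add_PIdl_iff:
  "y \<in> J <+> PIdl x \<longleftrightarrow> (\<exists>j\<in>J. \<exists>r\<in>carrier R. y = j \<oplus> r \<otimes> x)"
  unfolding set_add_def' cgenideal_def by blast

lemma ideal_add_PIdl:
  assumes "ideal J R" and "x \<in> carrier R"
  shows "ideal (J <+> PIdl x) R" and "J \<subseteq> J <+> PIdl x" and "x \<in> J <+> PIdl x"
proof -
  interpret ideal J R by (rule assms(1))
  show "ideal (J <+> PIdl x) R"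
    using add_ideals assms cgenideal_ideal by blast
  show "J \<subseteq> J <+> PIdl x"
  proof
    fix j assume "j \<in> J"
    then have "j = j \<oplus> \<zero> \<otimes> x" using assms(2) Icarr by simp
    then show "j \<in> J <+> PIdl x" using \<open>j \<in> J\<close> unfolding in_add_PIdl_iff by blast
  qed
  have "x = \<zero> \<oplus> \<one> \<otimes> x" using assms(2) by simp
  then show "x \<in> J <+> PIdl x" unfolding in_add_PIdl_iff using additive_subgroup.zero_closed
    using additive_subgroup_axioms by blast
qed

lemma add_PIdl_subset:
  assumes "ideal J R" and "x \<in> J" and "I \<subseteq> J"
  shows "I <+> PIdl x \<subseteq> J"
proof -
  interpret ideal J R by (rule assms(1))
  show ?thesis unfolding in_add_PIdl_iff subset_iff using assms I_l_closed by blast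
qed

lemma colon_ideal:
  assumes "ideal I R" and "x \<in> carrier R"
  shows "ideal {r \<in> carrier R. r \<otimes> x \<in> I} R"
proof -
  interpret ideal I R by (rule assms(1))
  show ?thesis
    by (rule idealI_cring) (use assms(2) in \<open>auto simp: l_distr m_assoc I_l_closed\<close>)
qed

text \<open>
  A Noetherian ring \<open>R / I\<^sub>0\<close> in which every nonunit is nilpotent is Artinian. Take \<open>I\<close> maximal among the
  ideals for which the chain \<open>J n \<inter> I\<close> becomes constant. If \<open>I\<close> is proper, there is \<open>x \<notin> I\<close> that all
  nonunits multiply into \<open>I\<close>, so nothing lies strictly between \<open>I\<close> and \<open>I + xR\<close>, and the chain also
  becomes constant on \<open>I + xR\<close>.
\<close>

lemma descending_ideals_stabilise:
  assumes noeth: "noetherian_above R I\<^sub>0" and I0: "ideal I\<^sub>0 R"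
    and nilp: "\<And>g. g \<in> carrier R \<Longrightarrow> g \<notin> Units R \<Longrightarrow> \<exists>e::nat. g [^] e \<in> I\<^sub>0"
    and J: "\<And>n. ideal (J n) R" "\<And>n. I\<^sub>0 \<subseteq> J n" "\<And>n. J (Suc n) \<subseteq> J n"
  shows "\<exists>n. J (Suc n) = J n"
proof -
  have anti: "J n \<subseteq> J m" if "m \<le> n" for m n
    using lift_Suc_antimono_le[of J, OF J(3) that] .
  define \<F> where "\<F> = {I. ideal I R \<and> I\<^sub>0 \<subseteq> I \<and> (\<exists>m. \<forall>n\<ge>m. J n \<inter> I = J m \<inter> I)}"
  have "J n \<inter> I\<^sub>0 = I\<^sub>0" for n using J(2)[of n] by blast
  then have "I\<^sub>0 \<in> \<F>" using I0 unfolding \<F>_def by blast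
  then obtain I where I: "I \<in> \<F>" and max: "\<And>I'. I' \<in> \<F> \<Longrightarrow> I \<subseteq> I' \<Longrightarrow> I' = I"
    by (rule noetherian_aboveE[OF noeth]) (unfold \<F>_def, blast+)
  from I obtain m where idI: "ideal I R" and I0I: "I\<^sub>0 \<subseteq> I"
    and m: "\<And>n. n \<ge> m \<Longrightarrow> J n \<inter> I = J m \<inter> I" unfolding \<F>_def by blast
  interpret I: ideal I R by (rule idI)
  have "I = carrier R"
  proof (rule ccontr)
    assume "I \<noteq> carrier R"
    then have one: "\<one> \<notin> I" using I.one_imp_carrier by blast
    \<comment> \<open>A maximal colon ideal of the proper ideal I contains every nonunit.\<close>
    define col where "col x = {r \<in> carrier R. r \<otimes> x \<in> I}" for x
    have "\<exists>x\<in>carrier R - I. \<forall>y\<in>carrier R - I. col x \<subseteq> col y \<longrightarrow> col y = col x"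
    proof -
      have col: "ideal (col x) R" "I\<^sub>0 \<subseteq> col x" if "x \<in> carrier R" for x
      proof -
        show "ideal (col x) R" unfolding col_def using colon_ideal idI that by blast
        show "I\<^sub>0 \<subseteq> col x" unfolding col_def using I0I I.Icarr I.I_r_closed that by blast
      qed
      have "col \<one> \<in> col ` (carrier R - I)" using one by blast
      then obtain M where "M \<in> col ` (carrier R - I)"
        and "\<And>L. L \<in> col ` (carrier R - I) \<Longrightarrow> M \<subseteq> L \<Longrightarrow> L = M"
        by (rule noetherian_aboveE[OF noeth]) (use col in blast)+
      then show ?thesis by (metis imageE image_eqI)
    qed
    then obtain x where x: "x \<in> carrier R" "x \<notin> I"
      and xmax: "\<And>y. y \<in> carrier R \<Longrightarrow> y \<notin> I \<Longrightarrow> col x \<subseteq> col y \<Longrightarrow> col y = col x" by blast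
    have soc: "g \<otimes> x \<in> I" if g: "g \<in> carrier R" "g \<notin> Units R" for g
    proof -
      from nilp[OF g] obtain e :: nat where "g [^] e \<in> I" using I0I by blast
      then have ex: "\<exists>e::nat. g [^] e \<otimes> x \<in> I" using x I.I_r_closed by blast
      \<comment> \<open>At the least exponent, passing from x to y keeps the colon ideal and adds g to it.\<close>
      define e where "e = (LEAST e::nat. g [^] e \<otimes> x \<in> I)"
      have e: "g [^] e \<otimes> x \<in> I" unfolding e_def by (rule LeastI_ex[OF ex])
      then have "e \<noteq> 0" using x by (cases e) auto
      then obtain e' where e': "e = Suc e'" using not0_implies_Suc by blast
      define y where "y = g [^] e' \<otimes> x"
      have y: "y \<in> carrier R" using g x by (simp add: y_def)
      have yI: "y \<notin> I" unfolding y_def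
        using not_less_Least[of e' "\<lambda>e. g [^] e \<otimes> x \<in> I"] e' unfolding e_def[symmetric] by simp
      have "col x \<subseteq> col y"
      proof
        fix r assume "r \<in> col x"
        then have r: "r \<in> carrier R" "r \<otimes> x \<in> I" by (auto simp: col_def)
        have "r \<otimes> y = g [^] e' \<otimes> (r \<otimes> x)" unfolding y_def using r g x by (simp add: m_lcomm)
        then show "r \<in> col y" using r g I.I_l_closed by (simp add: col_def)
      qed
      then have "col y = col x" using xmax y yI by blast
      moreover have "g \<in> col y"
        using e g x unfolding e' col_def y_def by (simp add: m_assoc[symmetric] m_comm)
      ultimately show ?thesis by (simp add: col_def)
    qed
    define I' where "I' = I <+> PIdl x"
    have I': "ideal I' R" "I \<subseteq> I'" "x \<in> I'"
      unfolding I'_def using ideal_add_PIdl[OF idI x(1)] by auto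
    interpret I': ideal I' R by (rule I'(1))
    have "\<exists>m. \<forall>n\<ge>m. J n \<inter> I' = J m \<inter> I'"
    proof (cases "\<exists>k\<ge>m. J k \<inter> I' \<subseteq> I")
      case True
      then obtain k where k: "k \<ge> m" "J k \<inter> I' \<subseteq> I" by blast
      have "J n \<inter> I' = J n \<inter> I" if "n \<ge> k" for n using anti[OF that] k(2) I'(2) by blast
      then have "J n \<inter> I' = J k \<inter> I'" if "n \<ge> k" for n
        using m[of n] m[of k] that k(1) by simp
      then show ?thesis by blast
    next
      case False
      \<comment> \<open>Every \<open>J n\<close> contains some \<open>j + u x\<close> with \<open>u\<close> a unit, so \<open>z\<close> can be corrected into \<open>I\<close>.\<close>
      have "J m \<inter> I' \<subseteq> J n" if n: "n \<ge> m" for n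
      proof
        fix z assume z: "z \<in> J m \<inter> I'"
        from False n obtain w where w: "w \<in> J n" "w \<in> I'" "w \<notin> I" by blast
        interpret Jn: ideal "J n" R by (rule J)
        interpret Jm: ideal "J m" R by (rule J)
        from z have "z \<in> I'" by blast
        then obtain i r where z': "i \<in> I" "r \<in> carrier R" "z = i \<oplus> r \<otimes> x"
          unfolding I'_def in_add_PIdl_iff by blast
        from w obtain j u where w': "j \<in> I" "u \<in> carrier R" "w = j \<oplus> u \<otimes> x"
          unfolding I'_def in_add_PIdl_iff by blast
        have u: "u \<in> Units R"
        proof (rule ccontr)
          assume "u \<notin> Units R"
          then have "u \<otimes> x \<in> I" using soc w' by blast
          then show False using w w' I.a_closed by blast
        qed
        define v where "v = r \<otimes> inv u"
        have v: "v \<in> carrier R" using z' u by (simp add: v_def)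
        have vu: "v \<otimes> u = r" using z' u Units_closed[OF u] by (simp add: v_def m_assoc)
        have c: "i \<in> carrier R" "j \<in> carrier R" using z' w' I.Icarr by blast+
        have vw: "v \<otimes> w = v \<otimes> j \<oplus> r \<otimes> x"
          using c v w' x by (simp add: r_distr m_assoc[symmetric] vu)
        have eq: "z = (i \<ominus> v \<otimes> j) \<oplus> v \<otimes> w"
          unfolding vw z'(3) using c v z' x by algebra
        have "i \<ominus> v \<otimes> j \<in> I"
          using z' w' v I.I_l_closed I.a_inv_closed I.a_closed by (simp add: a_minus_def)
        moreover have "i \<ominus> v \<otimes> j = z \<ominus> v \<otimes> w"
          unfolding vw z'(3) using c v z' x by algebra
        moreover have "w \<in> J m" using w n anti by blast
        then have "z \<ominus> v \<otimes> w \<in> J m"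
          using z v Jm.I_l_closed Jm.a_inv_closed Jm.a_closed by (simp add: a_minus_def)
        ultimately have "i \<ominus> v \<otimes> j \<in> J n" using m[OF n] by auto
        then show "z \<in> J n" unfolding eq using w v Jn.I_l_closed Jn.a_closed by simp
      qed
      then have "J n \<inter> I' = J m \<inter> I'" if "n \<ge> m" for n using anti[OF that] that by blast
      then show ?thesis by blast
    qed
    then have "I' \<in> \<F>" using I' I0I unfolding \<F>_def by blast
    then have "I' = I" using max I'(2) by blast
    then show False using I'(3) x by blast
  qed
  then have "J (Suc m) \<inter> carrier R = J m \<inter> carrier R" using m[of "Suc m"] by simp
  moreover have "J n \<subseteq> carrier R" for n using ideal.Icarr[OF J(1)] by blast
  ultimately show ?thesis by blast
qed

text \<open>
  The nonunits are the radical of \<open>bR\<close>, hence an ideal, and \<open>\<one> \<ominus> t \<otimes> b\<close> is congruent to \<open>\<one>\<close> modulo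
  \<open>b\<close>: a power of it in \<open>bR\<close> would make \<open>b\<close> a unit.
\<close>

lemma one_minus_multiple_Units:
  assumes b: "b \<in> carrier R" "b \<notin> Units R"
    and rad: "\<And>g. g \<in> carrier R \<Longrightarrow> g \<notin> Units R \<Longrightarrow> \<exists>e::nat. g [^] e \<in> PIdl b"
    and t: "t \<in> carrier R"
  shows "\<one> \<ominus> t \<otimes> b \<in> Units R"
proof (rule ccontr)
  assume "\<one> \<ominus> t \<otimes> b \<notin> Units R"
  then obtain e :: nat where e: "(\<one> \<ominus> t \<otimes> b) [^] e \<in> PIdl b"
    using rad[of "\<one> \<ominus> t \<otimes> b"] b t by auto
  have pow: "\<exists>c\<in>carrier R. (\<one> \<ominus> t \<otimes> b) [^] e = \<one> \<ominus> c \<otimes> b" for e :: nat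
  proof (induction e)
    case 0
    have "\<one> = \<one> \<ominus> \<zero> \<otimes> b" using b by algebra
    then show ?case by (metis nat_pow_0 zero_closed)
  next
    case (Suc e)
    then obtain c where c: "c \<in> carrier R" "(\<one> \<ominus> t \<otimes> b) [^] e = \<one> \<ominus> c \<otimes> b" by blast
    have "(\<one> \<ominus> c \<otimes> b) \<otimes> (\<one> \<ominus> t \<otimes> b) = \<one> \<ominus> (c \<oplus> t \<ominus> c \<otimes> b \<otimes> t) \<otimes> b"
      using b t c(1) by algebra
    then show ?case using c b t by auto
  qed
  obtain c where c: "c \<in> carrier R" "(\<one> \<ominus> t \<otimes> b) [^] e = \<one> \<ominus> c \<otimes> b" using pow by blast
  obtain r where r: "r \<in> carrier R" "(\<one> \<ominus> t \<otimes> b) [^] e = r \<otimes> b"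
    using e unfolding cgenideal_def by blast
  have "(r \<oplus> c) \<otimes> b = (\<one> \<ominus> c \<otimes> b) \<oplus> c \<otimes> b" using r c b by (simp add: l_distr)
  also have "\<dots> = \<one>" using c b by algebra
  finally have "(r \<oplus> c) \<otimes> b = \<one>" .
  moreover from this have "b \<otimes> (r \<oplus> c) = \<one>" using m_comm b r c by simp
  ultimately have "b \<in> Units R" unfolding Units_def using b r c by blast
  then show False using b by blast
qed

lemma prime_pow_notin:
  assumes "primeideal p R" and "a \<in> carrier R" and "a \<notin> p"
  shows "a [^] (n::nat) \<notin> p"
proof (induction n)
  case 0
  interpret primeideal p R by (rule assms)
  show ?case using one_imp_carrier I_notcarr by auto
next
  case (Suc n)
  interpret primeideal p R by (rule assms)
  show ?case using Suc assms I_prime[of "a [^] n" a] by auto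
qed

text \<open>
  Krull's principal ideal theorem for \<open>R / p\<close>, in the case of a local ring whose maximal ideal is the
  radical of \<open>bR\<close>: a prime that contains \<open>p\<close> but not \<open>b\<close> is \<open>p\<close> itself. Take \<open>a\<close> in \<open>q\<close> but not in \<open>p\<close>. The
  ideals \<open>J n\<close>, obtained by saturating \<open>p + a\<^sup>n R\<close> with respect to the complement of \<open>q\<close>, become
  constant modulo \<open>b\<close>, as \<open>R / (p + bR)\<close> is Artinian. Since \<open>b \<notin> q\<close> can be cancelled,
  \<open>J n = J (n + 1) + b J n\<close>, so \<open>J n = J (n + 1)\<close> by Nakayama's lemma. Then \<open>s \<otimes> a\<^sup>n\<close> lies in
  \<open>p + a\<^sup>n\<^sup>+\<^sup>1 R\<close> for some \<open>s \<notin> q\<close>, and cancelling \<open>a\<^sup>n\<close> modulo \<open>p\<close> puts \<open>s\<close> into \<open>q\<close>.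
\<close>

theorem principal_ideal_theorem:
  assumes noeth: "noetherian_above R p" and p: "primeideal p R" and q: "primeideal q R"
    and pq: "p \<subseteq> q" and b: "b \<in> carrier R" "b \<notin> q" "b \<notin> Units R"
    and rad: "\<And>g. g \<in> carrier R \<Longrightarrow> g \<notin> Units R \<Longrightarrow> \<exists>e::nat. g [^] e \<in> PIdl b"
  shows "q = p"
proof (rule ccontr)
  assume "q \<noteq> p"
  then obtain a where a: "a \<in> q" "a \<notin> p" using pq by blast
  interpret p: primeideal p R by (rule p)
  interpret q: primeideal q R by (rule q)
  have ac: "a \<in> carrier R" using a q.Icarr by blast
  have oneq: "\<one> \<notin> q" using q.one_imp_carrier q.I_notcarr by auto
  define J where "J n = {x \<in> carrier R. \<exists>s\<in>carrier R - q. s \<otimes> x \<in> p <+> PIdl (a [^] n)}" for n :: nat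
  have pn: "ideal (p <+> PIdl (a [^] n)) R" "p \<subseteq> p <+> PIdl (a [^] n)"
    "a [^] n \<in> p <+> PIdl (a [^] n)" for n :: nat
    using ideal_add_PIdl[OF p.ideal_axioms, of "a [^] n"] ac by auto
  have sub: "p <+> PIdl (a [^] n) \<subseteq> J n" for n
  proof
    fix x assume x: "x \<in> p <+> PIdl (a [^] n)"
    have "x \<in> carrier R" by (rule ideal.Icarr[OF pn(1) x])
    then show "x \<in> J n" unfolding J_def using x oneq by (auto intro!: bexI[of _ \<one>])
  qed
  have Jid: "ideal (J n) R" for n
  proof (rule idealI_cring)
    interpret N: ideal "p <+> PIdl (a [^] n)" R by (rule pn)
    show "\<zero> \<in> J n" using sub N.zero_closed by blast
    show "x \<oplus> y \<in> J n" if xy: "x \<in> J n" "y \<in> J n" for x y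
    proof -
      from xy obtain s t where st: "x \<in> carrier R" "y \<in> carrier R"
        "s \<in> carrier R" "s \<notin> q" "s \<otimes> x \<in> p <+> PIdl (a [^] n)"
        "t \<in> carrier R" "t \<notin> q" "t \<otimes> y \<in> p <+> PIdl (a [^] n)" unfolding J_def by blast
      have "(s \<otimes> t) \<otimes> (x \<oplus> y) = t \<otimes> (s \<otimes> x) \<oplus> s \<otimes> (t \<otimes> y)" using st by algebra
      also have "\<dots> \<in> p <+> PIdl (a [^] n)" using st N.I_l_closed N.a_closed by blast
      finally show ?thesis unfolding J_def using st q.I_prime[of s t] by blast
    qed
    show "r \<otimes> x \<in> J n" if rx: "r \<in> carrier R" "x \<in> J n" for r x
    proof -
      from rx obtain s where s: "x \<in> carrier R"
        "s \<in> carrier R" "s \<notin> q" "s \<otimes> x \<in> p <+> PIdl (a [^] n)" unfolding J_def by blast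
      have "s \<otimes> (r \<otimes> x) = r \<otimes> (s \<otimes> x)" using s rx by algebra
      also have "\<dots> \<in> p <+> PIdl (a [^] n)" using s rx N.I_l_closed by blast
      finally show ?thesis unfolding J_def using s rx by blast
    qed
  qed (auto simp: J_def)
  have Jdec: "J (Suc n) \<subseteq> J n" for n
  proof -
    interpret N: ideal "p <+> PIdl (a [^] n)" R by (rule pn)
    have "a [^] Suc n \<in> p <+> PIdl (a [^] n)" using pn(3) N.I_r_closed ac by simp
    then have "p <+> PIdl (a [^] Suc n) \<subseteq> p <+> PIdl (a [^] n)"
      by (rule add_PIdl_subset[OF pn(1) _ pn(2)])
    then show ?thesis unfolding J_def by blast
  qed
  have pJ: "p \<subseteq> J n" for n using sub pn(2) by blast
  have "\<exists>n. J (Suc n) <+> PIdl b = J n <+> PIdl b"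
  proof (rule descending_ideals_stabilise)
    show "noetherian_above R (p <+> PIdl b)"
      using noetherian_above_mono[OF noeth] ideal_add_PIdl(2)[OF p.ideal_axioms b(1)] by blast
    show "ideal (p <+> PIdl b) R" using ideal_add_PIdl(1)[OF p.ideal_axioms b(1)] .
    have "PIdl b \<subseteq> p <+> PIdl b"
      using cgenideal_minimal ideal_add_PIdl[OF p.ideal_axioms b(1)] by blast
    then show "\<exists>e::nat. g [^] e \<in> p <+> PIdl b" if "g \<in> carrier R" "g \<notin> Units R" for g
      using rad[OF that] by blast
    show "ideal (J n <+> PIdl b) R" for n using ideal_add_PIdl(1)[OF Jid b(1)] .
    show "p <+> PIdl b \<subseteq> J n <+> PIdl b" for n
      using pJ unfolding subset_iff in_add_PIdl_iff by blast
    show "J (Suc n) <+> PIdl b \<subseteq> J n <+> PIdl b" for n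
      using Jdec unfolding subset_iff in_add_PIdl_iff by blast
  qed
  then obtain n where n: "J (Suc n) <+> PIdl b = J n <+> PIdl b" by blast
  interpret Jn: ideal "J n" R by (rule Jid)
  interpret Js: ideal "J (Suc n)" R by (rule Jid)
  have dec: "\<exists>y\<in>J (Suc n). \<exists>r\<in>J n. x = y \<oplus> r \<otimes> b" if x: "x \<in> J n" for x
  proof -
    have "x \<in> J (Suc n) <+> PIdl b" using x ideal_add_PIdl(2)[OF Jid b(1)] n by blast
    then obtain y r where yr: "y \<in> J (Suc n)" "r \<in> carrier R" "x = y \<oplus> r \<otimes> b"
      unfolding in_add_PIdl_iff by blast
    have yc: "y \<in> carrier R" using yr Js.Icarr by blast
    have "r \<otimes> b = x \<ominus> y" unfolding yr(3) using yr(2) yc b by algebra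
    also have "\<dots> \<in> J n" using x yr(1) Jdec Jn.a_closed Jn.a_inv_closed
      by (metis a_minus_def subsetD)
    finally obtain s where s: "s \<in> carrier R" "s \<notin> q" "s \<otimes> (r \<otimes> b) \<in> p <+> PIdl (a [^] n)"
      unfolding J_def by blast
    have "(s \<otimes> b) \<otimes> r \<in> p <+> PIdl (a [^] n)" using s yr(2) b by (simp add: m_ac)
    moreover have "s \<otimes> b \<in> carrier R - q" using q.I_prime[of s b] s b by blast
    ultimately have "r \<in> J n" unfolding J_def using yr(2) by blast
    then show ?thesis using yr by blast
  qed
  \<comment> \<open>Nakayama's lemma by the maximum condition: if \<open>E x\<close> is maximal and \<open>x = y + r b\<close>, then \<open>E r = E x\<close>,
    so \<open>r = y' + t x\<close> with \<open>y'\<close> in \<open>J (Suc n)\<close>, and \<open>(1 - t b) r\<close> lies in \<open>J (Suc n)\<close>.\<close>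
  define E where "E x = J (Suc n) <+> PIdl x" for x
  have E: "ideal (E x) R" "J (Suc n) \<subseteq> E x" "x \<in> E x" if "x \<in> J n" for x
    unfolding E_def using ideal_add_PIdl[OF Jid] that Jn.Icarr by auto
  have L: "ideal L R" "p \<subseteq> L" if "L \<in> E ` J n" for L
    using that E(1) apply blast using that E(2) pJ by blast
  have "E (a [^] n) \<in> E ` J n" using sub pn(3) by blast
  then obtain M where "M \<in> E ` J n" and Mm: "\<And>L. L \<in> E ` J n \<Longrightarrow> M \<subseteq> L \<Longrightarrow> L = M"
    by (rule noetherian_aboveE[OF noeth]) (use L in blast)+
  then obtain x where x: "x \<in> J n" "M = E x" by blast
  obtain y r where yr: "y \<in> J (Suc n)" "r \<in> J n" "x = y \<oplus> r \<otimes> b" using dec[OF x(1)] by blast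
  have "E x \<subseteq> E r" unfolding E_def[of x]
  proof (rule add_PIdl_subset)
    interpret Er: ideal "E r" R by (rule E(1)[OF yr(2)])
    show "ideal (E r) R" "J (Suc n) \<subseteq> E r" using E yr(2) by blast+
    show "x \<in> E r" unfolding yr(3)
      using E(3)[OF yr(2)] subsetD[OF E(2)[OF yr(2)] yr(1)] b(1) Er.a_closed Er.I_r_closed by blast
  qed
  then have Er: "E r = M" using Mm x yr(2) by blast
  then have "r \<in> E x" using E(3)[OF yr(2)] x by simp
  then obtain y' t where y't: "y' \<in> J (Suc n)" "t \<in> carrier R" "r = y' \<oplus> t \<otimes> x"
    unfolding E_def in_add_PIdl_iff by blast
  have c: "y \<in> carrier R" "y' \<in> carrier R" "r \<in> carrier R"
    using yr y't Js.Icarr Jn.Icarr by blast+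
  have "(\<one> \<ominus> t \<otimes> b) \<otimes> r = r \<ominus> t \<otimes> (r \<otimes> b)" using c y't(2) b by algebra
  also have "\<dots> = (y' \<oplus> t \<otimes> (y \<oplus> r \<otimes> b)) \<ominus> t \<otimes> (r \<otimes> b)" using y't(3) yr(3) by simp
  also have "\<dots> = y' \<oplus> t \<otimes> y" using c y't(2) b by algebra
  also have "\<dots> \<in> J (Suc n)" using y't yr Js.a_closed Js.I_l_closed by blast
  finally have ur: "(\<one> \<ominus> t \<otimes> b) \<otimes> r \<in> J (Suc n)" .
  have u: "\<one> \<ominus> t \<otimes> b \<in> Units R"
    by (rule one_minus_multiple_Units[OF b(1,3) _ y't(2)]) (use rad in blast)
  have "r = inv (\<one> \<ominus> t \<otimes> b) \<otimes> ((\<one> \<ominus> t \<otimes> b) \<otimes> r)"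
    using u c by (simp add: m_assoc[symmetric] Units_closed)
  then have "r \<in> J (Suc n)" using ur Js.I_l_closed u by (metis Units_inv_closed)
  then have "M \<subseteq> J (Suc n)" unfolding Er[symmetric] E_def using add_PIdl_subset[OF Jid] by blast
  moreover have an: "a [^] n \<in> J n" using sub pn(3) by blast
  ultimately have "E (a [^] n) = M" using Mm E(2)[OF an] by blast
  then have "a [^] n \<in> J (Suc n)" using E(3)[OF an] \<open>M \<subseteq> J (Suc n)\<close> by blast
  then obtain s where s: "s \<in> carrier R" "s \<notin> q" "s \<otimes> a [^] n \<in> p <+> PIdl (a [^] Suc n)"
    unfolding J_def by blast
  then obtain j c where jc: "j \<in> p" "c \<in> carrier R" "s \<otimes> a [^] n = j \<oplus> c \<otimes> (a [^] Suc n)"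
    unfolding in_add_PIdl_iff by blast
  have jc': "j \<in> carrier R" using jc p.Icarr by blast
  have an': "a [^] n \<in> carrier R" using ac by simp
  have "a [^] n \<otimes> (s \<ominus> c \<otimes> a) = s \<otimes> a [^] n \<ominus> c \<otimes> (a [^] n \<otimes> a)"
    using an' s(1) jc(2) ac by algebra
  also have "\<dots> = (j \<oplus> c \<otimes> (a [^] n \<otimes> a)) \<ominus> c \<otimes> (a [^] n \<otimes> a)" using jc(3) by simp
  also have "\<dots> = j" using an' jc(2) jc' ac by algebra
  finally have "a [^] n \<otimes> (s \<ominus> c \<otimes> a) \<in> p" using jc by simp
  then have "s \<ominus> c \<otimes> a \<in> q"
    using p.I_prime[of "a [^] n" "s \<ominus> c \<otimes> a"] prime_pow_notin[OF p ac a(2), of n] pq an' s jc ac by auto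
  moreover have "c \<otimes> a \<in> q" using a jc q.I_l_closed by blast
  ultimately have "(s \<ominus> c \<otimes> a) \<oplus> c \<otimes> a \<in> q" using q.a_closed by blast
  moreover have "(s \<ominus> c \<otimes> a) \<oplus> c \<otimes> a = s" using s jc ac by algebra
  ultimately show False using s by simp
qed

end

section \<open>Rings generated by one element and the basis theorem\<close>

text \<open>
  The values at \<open>x\<close> of the polynomials of degree less than \<open>d\<close> with coefficients in \<open>M\<close>. The set \<open>M\<close> may be
  just an additive subgroup: besides subrings, the proof of Chevalley's theorem needs coefficients
  from a set that does not contain \<open>\<one>\<close>.
\<close>

primrec poly_values :: "('a, 'm) ring_scheme \<Rightarrow> 'a set \<Rightarrow> 'a \<Rightarrow> nat \<Rightarrow> 'a set" where
  "poly_values R M x 0 = {\<zero>\<^bsub>R\<^esub>}"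
| "poly_values R M x (Suc d) =
     {u \<oplus>\<^bsub>R\<^esub> c \<otimes>\<^bsub>R\<^esub> x [^]\<^bsub>R\<^esub> d | u c. u \<in> poly_values R M x d \<and> c \<in> M}"

definition adjoin :: "('a, 'm) ring_scheme \<Rightarrow> 'a set \<Rightarrow> 'a \<Rightarrow> 'a set" where
  "adjoin R M x = (\<Union>d. poly_values R M x d)"

context cring
begin

lemma additive_subgroupI_cring:
  assumes "M \<subseteq> carrier R" and "\<zero> \<in> M"
    and "\<And>x y. x \<in> M \<Longrightarrow> y \<in> M \<Longrightarrow> x \<oplus> y \<in> M" and "\<And>x. x \<in> M \<Longrightarrow> \<ominus> x \<in> M"
  shows "additive_subgroup M R"
proof (rule additive_subgroupI)
  show "subgroup M (add_monoid R)"
    by (rule add.subgroupI) (use assms in auto)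
qed

lemma subring_cring: "subring A R \<Longrightarrow> cring (R\<lparr>carrier := A\<rparr>)"
  using subcringI' subcring_iff subringE(1) by blast

lemma subring_additive_subgroup: "subring A R \<Longrightarrow> additive_subgroup A R"
  by (rule additive_subgroupI_cring) (auto dest: subringE)

lemma ideal_subring_iff:
  assumes A: "subring A R"
  shows "ideal J (R\<lparr>carrier := A\<rparr>) \<longleftrightarrow>
    J \<subseteq> A \<and> \<zero> \<in> J \<and> (\<forall>x\<in>J. \<forall>y\<in>J. x \<oplus> y \<in> J) \<and> (\<forall>r\<in>A. \<forall>x\<in>J. r \<otimes> x \<in> J)"
proof -
  interpret A: cring "R\<lparr>carrier := A\<rparr>" by (rule subring_cring[OF A])
  show ?thesis
  proof
    assume "ideal J (R\<lparr>carrier := A\<rparr>)"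
    then interpret J: ideal J "R\<lparr>carrier := A\<rparr>" .
    show "J \<subseteq> A \<and> \<zero> \<in> J \<and> (\<forall>x\<in>J. \<forall>y\<in>J. x \<oplus> y \<in> J) \<and> (\<forall>r\<in>A. \<forall>x\<in>J. r \<otimes> x \<in> J)"
      using J.a_subset J.zero_closed J.a_closed J.I_l_closed by auto
  next
    assume "J \<subseteq> A \<and> \<zero> \<in> J \<and> (\<forall>x\<in>J. \<forall>y\<in>J. x \<oplus> y \<in> J) \<and> (\<forall>r\<in>A. \<forall>x\<in>J. r \<otimes> x \<in> J)"
    then show "ideal J (R\<lparr>carrier := A\<rparr>)" by (intro A.idealI_cring) auto
  qed
qed

lemma primeideal_subring_iff:
  assumes A: "subring A R"
  shows "primeideal Q (R\<lparr>carrier := A\<rparr>) \<longleftrightarrow>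
    ideal Q (R\<lparr>carrier := A\<rparr>) \<and> \<one> \<notin> Q \<and> (\<forall>x\<in>A. \<forall>y\<in>A. x \<otimes> y \<in> Q \<longrightarrow> x \<in> Q \<or> y \<in> Q)"
proof -
  interpret A: cring "R\<lparr>carrier := A\<rparr>" by (rule subring_cring[OF A])
  show ?thesis
  proof
    assume "primeideal Q (R\<lparr>carrier := A\<rparr>)"
    then interpret Q: primeideal Q "R\<lparr>carrier := A\<rparr>" .
    show "ideal Q (R\<lparr>carrier := A\<rparr>) \<and> \<one> \<notin> Q \<and> (\<forall>x\<in>A. \<forall>y\<in>A. x \<otimes> y \<in> Q \<longrightarrow> x \<in> Q \<or> y \<in> Q)"
      using Q.one_imp_carrier Q.I_notcarr Q.I_prime Q.ideal_axioms by auto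
  next
    assume *: "ideal Q (R\<lparr>carrier := A\<rparr>) \<and> \<one> \<notin> Q \<and> (\<forall>x\<in>A. \<forall>y\<in>A. x \<otimes> y \<in> Q \<longrightarrow> x \<in> Q \<or> y \<in> Q)"
    show "primeideal Q (R\<lparr>carrier := A\<rparr>)"
    proof (rule primeidealI)
      have "\<one> \<in> A" using A.one_closed by simp
      then show "carrier (R\<lparr>carrier := A\<rparr>) \<noteq> Q" using * by auto
    qed (use * A.cring_axioms in auto)
  qed
qed

lemma poly_values_closed:
  assumes "M \<subseteq> carrier R" and "x \<in> carrier R"
  shows "poly_values R M x d \<subseteq> carrier R"
  by (induction d) (use assms in auto)

lemma poly_values_SucI:
  "u \<in> poly_values R M x d \<Longrightarrow> c \<in> M \<Longrightarrow> u \<oplus> c \<otimes> x [^] d \<in> poly_values R M x (Suc d)"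
  by auto

lemma poly_values_mono:
  assumes "additive_subgroup M R" and "x \<in> carrier R" and "d \<le> e"
  shows "poly_values R M x d \<subseteq> poly_values R M x e"
proof -
  interpret M: additive_subgroup M R by (rule assms(1))
  have "poly_values R M x d \<subseteq> poly_values R M x (Suc d)" for d
  proof
    fix u assume u: "u \<in> poly_values R M x d"
    then have "u \<in> carrier R" using poly_values_closed[OF M.a_subset assms(2), of d] by blast
    then have "u \<oplus> \<zero> \<otimes> x [^] d = u" using assms(2) by simp
    then show "u \<in> poly_values R M x (Suc d)" using poly_values_SucI[OF u M.zero_closed] by simp
  qed
  then show ?thesis using assms(3) by (rule lift_Suc_mono_le)
qed

lemma poly_values_additive_subgroup:
  assumes "additive_subgroup M R" and x: "x \<in> carrier R"
  shows "additive_subgroup (poly_values R M x d) R"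
proof -
  interpret M: additive_subgroup M R by (rule assms(1))
  have Mc: "\<And>c. c \<in> M \<Longrightarrow> c \<in> carrier R" using M.a_subset by blast
  show ?thesis
  proof (induction d)
    case 0
    show ?case by (rule additive_subgroupI_cring) auto
  next
    case (Suc d)
    interpret U: additive_subgroup "poly_values R M x d" R by (rule Suc)
    have Uc: "\<And>c. c \<in> poly_values R M x d \<Longrightarrow> c \<in> carrier R" using U.a_subset by blast
    show ?case
    proof (rule additive_subgroupI_cring)
      show "poly_values R M x (Suc d) \<subseteq> carrier R" by (rule poly_values_closed[OF M.a_subset x])
      show "\<zero> \<in> poly_values R M x (Suc d)"
        by (rule subsetD[OF poly_values_mono[OF assms(1) x le_SucI[OF order_refl]] U.zero_closed])
    next
      fix y z assume "y \<in> poly_values R M x (Suc d)" "z \<in> poly_values R M x (Suc d)"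
      then obtain u c v e where h: "u \<in> poly_values R M x d" "c \<in> M" "y = u \<oplus> c \<otimes> x [^] d"
        "v \<in> poly_values R M x d" "e \<in> M" "z = v \<oplus> e \<otimes> x [^] d" by auto
      have "x [^] d \<in> carrier R" using x by simp
      then have "y \<oplus> z = (u \<oplus> v) \<oplus> (c \<oplus> e) \<otimes> x [^] d"
        unfolding h using Uc[OF h(1)] Uc[OF h(4)] Mc[OF h(2)] Mc[OF h(5)] by algebra
      then show "y \<oplus> z \<in> poly_values R M x (Suc d)"
        using U.a_closed[OF h(1,4)] M.a_closed[OF h(2,5)] by auto
    next
      fix y assume "y \<in> poly_values R M x (Suc d)"
      then obtain u c where h: "u \<in> poly_values R M x d" "c \<in> M" "y = u \<oplus> c \<otimes> x [^] d" by auto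
      have "x [^] d \<in> carrier R" using x by simp
      then have "\<ominus> y = \<ominus> u \<oplus> (\<ominus> c) \<otimes> x [^] d"
        unfolding h using Uc[OF h(1)] Mc[OF h(2)] by algebra
      then show "\<ominus> y \<in> poly_values R M x (Suc d)"
        using U.a_inv_closed[OF h(1)] M.a_inv_closed[OF h(2)] by auto
    qed
  qed
qed

lemma poly_values_monomial:
  assumes "additive_subgroup M R" and x: "x \<in> carrier R" and c: "c \<in> M" and i: "i < d"
  shows "c \<otimes> x [^] i \<in> poly_values R M x d"
proof -
  interpret M: additive_subgroup M R by (rule assms(1))
  interpret U: additive_subgroup "poly_values R M x i" R
    by (rule poly_values_additive_subgroup[OF assms(1) x])
  have "\<zero> \<oplus> c \<otimes> x [^] i = c \<otimes> x [^] i" using c x M.a_subset by auto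
  then have "c \<otimes> x [^] i \<in> poly_values R M x (Suc i)" using poly_values_SucI[OF U.zero_closed c] by simp
  then show ?thesis using poly_values_mono[OF assms(1) x, of "Suc i" d] i by auto
qed

lemma poly_values_scale:
  assumes "A \<subseteq> carrier R" and "M \<subseteq> carrier R" and x: "x \<in> carrier R"
    and AM: "\<And>a c. a \<in> A \<Longrightarrow> c \<in> M \<Longrightarrow> a \<otimes> c \<in> M" and a: "a \<in> A"
  shows "u \<in> poly_values R M x d \<Longrightarrow> a \<otimes> u \<in> poly_values R M x d"
proof (induction d arbitrary: u)
  case 0
  then show ?case using a assms(1) by auto
next
  case (Suc d)
  then obtain v c where h: "v \<in> poly_values R M x d" "c \<in> M" "u = v \<oplus> c \<otimes> x [^] d" by auto
  have cl: "v \<in> carrier R" "c \<in> carrier R" "a \<in> carrier R" "x [^] d \<in> carrier R"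
    using h a assms(1,2) x poly_values_closed[OF assms(2) x] by auto
  have "a \<otimes> u = a \<otimes> v \<oplus> (a \<otimes> c) \<otimes> x [^] d" unfolding h using cl by algebra
  then show ?case using Suc.IH[OF h(1)] AM[OF a h(2)] by auto
qed

lemma poly_values_Horner:
  assumes "additive_subgroup M R" and x: "x \<in> carrier R"
  shows "u \<in> poly_values R M x (Suc d) \<Longrightarrow> \<exists>c\<in>M. \<exists>v\<in>poly_values R M x d. u = c \<oplus> x \<otimes> v"
proof (induction d arbitrary: u)
  case 0
  interpret M: additive_subgroup M R by (rule assms(1))
  from 0 obtain c where "c \<in> M" "u = \<zero> \<oplus> c \<otimes> \<one>" by auto
  then have "c \<in> M" "u = c \<oplus> x \<otimes> \<zero>" using M.a_subset x by auto
  then show ?case by auto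
next
  case (Suc d)
  interpret M: additive_subgroup M R by (rule assms(1))
  from Suc.prems obtain v e where h: "v \<in> poly_values R M x (Suc d)" "e \<in> M"
    "u = v \<oplus> e \<otimes> x [^] Suc d" unfolding poly_values.simps(2)[of R M x "Suc d"] by blast
  from Suc.IH[OF h(1)] obtain c w where cw: "c \<in> M" "w \<in> poly_values R M x d" "v = c \<oplus> x \<otimes> w"
    by blast
  have cl: "c \<in> carrier R" "e \<in> carrier R" "w \<in> carrier R" "x [^] d \<in> carrier R"
    using cw h M.a_subset x poly_values_closed[OF M.a_subset x, of d] by auto
  have "u = (c \<oplus> x \<otimes> w) \<oplus> e \<otimes> (x [^] d \<otimes> x)" unfolding h(3) cw(3) by simp
  also have "\<dots> = c \<oplus> x \<otimes> (w \<oplus> e \<otimes> x [^] d)" using cl x by algebra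
  finally have "u = c \<oplus> x \<otimes> (w \<oplus> e \<otimes> x [^] d)" .
  moreover have "w \<oplus> e \<otimes> x [^] d \<in> poly_values R M x (Suc d)" using cw h by auto
  ultimately show ?case using cw(1) by blast
qed

lemma poly_values_shift:
  assumes "additive_subgroup M R" and x: "x \<in> carrier R"
  shows "u \<in> poly_values R M x d \<Longrightarrow> x [^] k \<otimes> u \<in> poly_values R M x (d + k)"
proof (induction d arbitrary: u)
  case 0
  interpret U: additive_subgroup "poly_values R M x k" R
    by (rule poly_values_additive_subgroup[OF assms(1) x])
  show ?case using 0 x U.zero_closed by simp
next
  case (Suc d)
  interpret M: additive_subgroup M R by (rule assms(1))
  from Suc.prems obtain v c where h: "v \<in> poly_values R M x d" "c \<in> M" "u = v \<oplus> c \<otimes> x [^] d" by auto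
  have cl: "v \<in> carrier R" "c \<in> carrier R" "x [^] d \<in> carrier R" "x [^] k \<in> carrier R"
    using h M.a_subset x poly_values_closed[OF M.a_subset x] by auto
  have "x [^] k \<otimes> u = x [^] k \<otimes> v \<oplus> c \<otimes> (x [^] d \<otimes> x [^] k)" unfolding h using cl by algebra
  then have "x [^] k \<otimes> u = x [^] k \<otimes> v \<oplus> c \<otimes> x [^] (d + k)" using x by (simp add: nat_pow_mult)
  then show ?case using Suc.IH[OF h(1)] h(2) by auto
qed

lemma poly_values_mult:
  assumes A: "additive_subgroup A R" and M: "additive_subgroup M R" and x: "x \<in> carrier R"
    and AM: "\<And>a c. a \<in> A \<Longrightarrow> c \<in> M \<Longrightarrow> a \<otimes> c \<in> M"
    and v: "v \<in> poly_values R M x e"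
  shows "u \<in> poly_values R A x d \<Longrightarrow> u \<otimes> v \<in> poly_values R M x (d + e)"
proof (induction d arbitrary: u)
  case 0
  interpret M: additive_subgroup M R by (rule M)
  interpret U: additive_subgroup "poly_values R M x e" R
    by (rule poly_values_additive_subgroup[OF M x])
  show ?case using 0 v U.zero_closed U.a_subset by auto
next
  case (Suc d)
  interpret A: additive_subgroup A R by (rule A)
  interpret M: additive_subgroup M R by (rule M)
  from Suc.prems obtain w c where h: "w \<in> poly_values R A x d" "c \<in> A" "u = w \<oplus> c \<otimes> x [^] d" by auto
  have cl: "w \<in> carrier R" "c \<in> carrier R" "x [^] d \<in> carrier R" "v \<in> carrier R"
    using h A.a_subset x v poly_values_closed[OF A.a_subset x, of d] poly_values_closed[OF M.a_subset x, of e] by auto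
  have "u \<otimes> v = w \<otimes> v \<oplus> x [^] d \<otimes> (c \<otimes> v)" unfolding h using cl by algebra
  moreover have "w \<otimes> v \<in> poly_values R M x (Suc d + e)"
    using Suc.IH[OF h(1)] poly_values_mono[OF M x, of "d + e" "Suc d + e"] by auto
  moreover have "c \<otimes> v \<in> poly_values R M x e"
    by (rule poly_values_scale[OF A.a_subset M.a_subset x _ h(2) v]) (use AM in blast)
  then have "x [^] d \<otimes> (c \<otimes> v) \<in> poly_values R M x (e + d)" by (rule poly_values_shift[OF M x])
  then have "x [^] d \<otimes> (c \<otimes> v) \<in> poly_values R M x (Suc d + e)"
    using poly_values_mono[OF M x, of "e + d" "Suc d + e"] by auto
  ultimately show ?case
    using additive_subgroup.a_closed[OF poly_values_additive_subgroup[OF M x]] by metis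
qed

text \<open>
  Multiplying by \<open>x\<^sup>n\<close> turns a polynomial in \<open>1/x\<close> of degree at most \<open>n\<close> into one in \<open>x\<close> with the
  coefficients reversed.
\<close>

lemma poly_values_reverse:
  assumes M: "additive_subgroup M R" and x: "x \<in> carrier R" and w: "w \<in> carrier R" "x \<otimes> w = \<one>"
  shows "u \<in> poly_values R M w m \<Longrightarrow> m \<le> Suc n \<Longrightarrow> x [^] n \<otimes> u \<in> poly_values R M x (Suc n)"
proof (induction m arbitrary: u)
  case 0
  interpret U: additive_subgroup "poly_values R M x (Suc n)" R
    by (rule poly_values_additive_subgroup[OF M x])
  show ?case using 0 x U.zero_closed by simp
next
  case (Suc m)
  interpret M: additive_subgroup M R by (rule M)
  from Suc.prems obtain v c where h: "v \<in> poly_values R M w m" "c \<in> M" "u = v \<oplus> c \<otimes> w [^] m" by auto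
  have cl: "v \<in> carrier R" "c \<in> carrier R" "w [^] m \<in> carrier R" "x [^] n \<in> carrier R"
    using h M.a_subset x w(1) poly_values_closed[OF M.a_subset w(1)] by auto
  have mn: "m \<le> n" using Suc.prems by simp
  have "x [^] n \<otimes> w [^] m = x [^] (n - m) \<otimes> (x [^] m \<otimes> w [^] m)"
    using x w mn by (simp add: m_assoc[symmetric] nat_pow_mult)
  also have "x [^] m \<otimes> w [^] m = \<one>" using x w by (simp add: nat_pow_distrib[symmetric])
  finally have e: "x [^] n \<otimes> w [^] m = x [^] (n - m)" using x by simp
  have "x [^] n \<otimes> u = x [^] n \<otimes> v \<oplus> c \<otimes> (x [^] n \<otimes> w [^] m)" unfolding h using cl by algebra
  then have "x [^] n \<otimes> u = x [^] n \<otimes> v \<oplus> c \<otimes> x [^] (n - m)" unfolding e .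
  moreover have "c \<otimes> x [^] (n - m) \<in> poly_values R M x (Suc n)"
    by (rule poly_values_monomial[OF M x h(2)]) simp
  moreover have "x [^] n \<otimes> v \<in> poly_values R M x (Suc n)" using Suc.IH[OF h(1)] mn by simp
  ultimately show ?case
    using additive_subgroup.a_closed[OF poly_values_additive_subgroup[OF M x]] by metis
qed

lemma adjoin_common_degree:
  assumes "additive_subgroup M R" and "x \<in> carrier R" and "u \<in> adjoin R M x" and "v \<in> adjoin R M x"
  obtains d where "u \<in> poly_values R M x d" and "v \<in> poly_values R M x d"
proof -
  from assms obtain d e where "u \<in> poly_values R M x d" "v \<in> poly_values R M x e"
    unfolding adjoin_def by blast
  then have "u \<in> poly_values R M x (max d e)" "v \<in> poly_values R M x (max d e)"
    using poly_values_mono[OF assms(1,2), of d "max d e"] poly_values_mono[OF assms(1,2), of e "max d e"]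
    by auto
  then show thesis by (rule that)
qed

lemma adjoin_additive_subgroup:
  assumes M: "additive_subgroup M R" and x: "x \<in> carrier R"
  shows "additive_subgroup (adjoin R M x) R"
proof (rule additive_subgroupI_cring)
  interpret M: additive_subgroup M R by (rule M)
  note U = poly_values_additive_subgroup[OF M x]
  show "adjoin R M x \<subseteq> carrier R" unfolding adjoin_def using poly_values_closed[OF M.a_subset x] by blast
  show "\<zero> \<in> adjoin R M x" unfolding adjoin_def using additive_subgroup.zero_closed[OF U] by blast
  show "u \<oplus> v \<in> adjoin R M x" if uv: "u \<in> adjoin R M x" "v \<in> adjoin R M x" for u v
  proof -
    obtain d where "u \<in> poly_values R M x d" "v \<in> poly_values R M x d"
      by (rule adjoin_common_degree[OF M x uv]) blast
    then have "u \<oplus> v \<in> poly_values R M x d" by (rule additive_subgroup.a_closed[OF U])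
    then show ?thesis unfolding adjoin_def by blast
  qed
  show "\<ominus> u \<in> adjoin R M x" if "u \<in> adjoin R M x" for u
    using that additive_subgroup.a_inv_closed[OF U] unfolding adjoin_def by blast
qed

lemma subset_adjoin:
  assumes "M \<subseteq> carrier R" and "x \<in> carrier R"
  shows "M \<subseteq> adjoin R M x"
proof
  fix c assume c: "c \<in> M"
  then have "c = \<zero> \<oplus> c \<otimes> x [^] (0::nat)" using assms by auto
  then have "c \<in> poly_values R M x (Suc 0)" using c by auto
  then show "c \<in> adjoin R M x" unfolding adjoin_def by blast
qed

lemma adjoin_mult:
  assumes A: "additive_subgroup A R" and M: "additive_subgroup M R" and x: "x \<in> carrier R"
    and AM: "\<And>a c. a \<in> A \<Longrightarrow> c \<in> M \<Longrightarrow> a \<otimes> c \<in> M"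
    and u: "u \<in> adjoin R A x" and v: "v \<in> adjoin R M x"
  shows "u \<otimes> v \<in> adjoin R M x"
  using u v poly_values_mult[OF A M x AM] unfolding adjoin_def by blast

lemma adjoin_mult_var:
  assumes "additive_subgroup M R" and "x \<in> carrier R" and "u \<in> adjoin R M x"
  shows "x \<otimes> u \<in> adjoin R M x"
proof -
  from assms(3) obtain d where "u \<in> poly_values R M x d" unfolding adjoin_def by blast
  then have "x \<otimes> u \<in> poly_values R M x (Suc d)"
    using poly_values_shift[OF assms(1,2), of u d 1] assms(2) by simp
  then show ?thesis unfolding adjoin_def by blast
qed

lemma adjoin_subring:
  assumes A: "subring A R" and x: "x \<in> carrier R"
  shows "subring (adjoin R A x) R" and "A \<subseteq> adjoin R A x" and "x \<in> adjoin R A x"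
proof -
  note Aa = subring_additive_subgroup[OF A]
  interpret U: additive_subgroup "adjoin R A x" R by (rule adjoin_additive_subgroup[OF Aa x])
  show *: "A \<subseteq> adjoin R A x" by (rule subset_adjoin[OF subringE(1)[OF A] x])
  then have one: "\<one> \<in> adjoin R A x" using subringE(3)[OF A] by blast
  then show "x \<in> adjoin R A x" using adjoin_mult_var[OF Aa x one] x by simp
  show "subring (adjoin R A x) R"
  proof (rule subringI)
    show "\<And>h1 h2. h1 \<in> adjoin R A x \<Longrightarrow> h2 \<in> adjoin R A x \<Longrightarrow> h1 \<otimes> h2 \<in> adjoin R A x"
      by (rule adjoin_mult[OF Aa Aa x]) (use subringE(6)[OF A] in blast)+
  qed (use U.a_subset U.a_closed U.a_inv_closed one in auto)
qed

lemma adjoin_least: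
  assumes "subring B R" and "A \<subseteq> B" and "x \<in> B"
  shows "adjoin R A x \<subseteq> B"
proof -
  note B = subringE[OF assms(1)]
  have pow: "x [^] (d::nat) \<in> B" for d by (induction d) (use assms B in auto)
  have "poly_values R A x d \<subseteq> B" for d
  proof (induction d)
    case (Suc d)
    show ?case
    proof
      fix z assume "z \<in> poly_values R A x (Suc d)"
      then obtain u c where h: "u \<in> poly_values R A x d" "c \<in> A" "z = u \<oplus> c \<otimes> x [^] d" by auto
      then have "u \<in> B" "c \<in> B" using Suc assms(2) by auto
      then show "z \<in> B" unfolding h(3) using B(6,7) pow by blast
    qed
  qed (use B in auto)
  then show ?thesis unfolding adjoin_def by blast
qed

text \<open>
  Hilbert's argument with leading coefficients, for a ring generated by one element rather than a
  polynomial ring. For an ideal \<open>J\<close> the set \<open>lead J d\<close> consists of the \<open>c\<close> for which \<open>J\<close> contains some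
  \<open>c x\<^sup>d +\<close> lower terms; an expression need not be unique. Comparable ideals
  with the same leading coefficients in all degrees are equal. Maximising some \<open>lead J d\<close> over all \<open>J\<close>
  and \<open>d\<close> settles all degrees from some \<open>d1\<close> on, and the finitely many smaller degrees are
  maximised one after the other.
\<close>

theorem Hilbert_basis:
  assumes A: "subring A R" and noeth: "noetherian_above (R\<lparr>carrier := A\<rparr>) T"
    and TA: "T \<subseteq> A" and x: "x \<in> carrier R"
  shows "noetherian_above (R\<lparr>carrier := adjoin R A x\<rparr>) T"
  unfolding noetherian_above_def
proof (intro allI impI)
  fix \<J> assume "\<J> \<noteq> {}" and id: "\<forall>J\<in>\<J>. ideal J (R\<lparr>carrier := adjoin R A x\<rparr>) \<and> T \<subseteq> J"
  define B where "B = adjoin R A x"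
  have B: "subring B R" "A \<subseteq> B" "x \<in> B" unfolding B_def using adjoin_subring[OF A x] by auto
  note Ac = subringE(1)[OF A] and Aa = subring_additive_subgroup[OF A]
  have powB: "x [^] (d::nat) \<in> B" for d by (induction d) (use B subringE[OF B(1)] in auto)
  have pvB: "poly_values R A x d \<subseteq> B" for d unfolding B_def adjoin_def by blast
  have Jsub: "J \<subseteq> B" and Jz: "\<zero> \<in> J" and Ja: "\<And>u v. u \<in> J \<Longrightarrow> v \<in> J \<Longrightarrow> u \<oplus> v \<in> J"
    and Jm: "\<And>r u. r \<in> B \<Longrightarrow> u \<in> J \<Longrightarrow> r \<otimes> u \<in> J" and TJ: "T \<subseteq> J" if "J \<in> \<J>" for J
    using id[rule_format, OF that] unfolding B_def[symmetric] ideal_subring_iff[OF B(1)] by blast+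
  have Jneg: "\<ominus> u \<in> J" if J: "J \<in> \<J>" and u: "u \<in> J" for J u
  proof -
    have "\<ominus> \<one> \<in> B" using subringE(3,5)[OF B(1)] by blast
    then have "\<ominus> \<one> \<otimes> u \<in> J" using Jm[OF J] u by blast
    moreover have "u \<in> carrier R" using u Jsub[OF J] subringE(1)[OF B(1)] by blast
    ultimately show ?thesis by (simp add: l_minus)
  qed
  define lead where "lead J d = {c \<in> A. \<exists>u\<in>poly_values R A x d. c \<otimes> x [^] d \<oplus> u \<in> J}" for J d
  have pvc: "u \<in> carrier R" if "u \<in> poly_values R A x d" for u d
    using that poly_values_closed[OF Ac x] by blast
  note pva = additive_subgroup.a_closed[OF poly_values_additive_subgroup[OF Aa x]]
  note pvz = additive_subgroup.zero_closed[OF poly_values_additive_subgroup[OF Aa x]]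
  note pvn = additive_subgroup.a_inv_closed[OF poly_values_additive_subgroup[OF Aa x]]
  have Lid: "ideal (lead J d) (R\<lparr>carrier := A\<rparr>)" if J: "J \<in> \<J>" for J d
    unfolding ideal_subring_iff[OF A]
  proof (intro conjI ballI)
    show "lead J d \<subseteq> A" unfolding lead_def by blast
    have "\<zero> \<otimes> x [^] d \<oplus> \<zero> \<in> J" using Jz[OF J] x by simp
    then show "\<zero> \<in> lead J d" unfolding lead_def using subringE(2)[OF A] pvz by blast
  next
    fix c e assume "c \<in> lead J d" "e \<in> lead J d"
    then obtain u v where h: "c \<in> A" "e \<in> A" "u \<in> poly_values R A x d" "v \<in> poly_values R A x d"
      "c \<otimes> x [^] d \<oplus> u \<in> J" "e \<otimes> x [^] d \<oplus> v \<in> J" unfolding lead_def by blast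
    have cl: "c \<in> carrier R" "e \<in> carrier R" "u \<in> carrier R" "v \<in> carrier R" "x [^] d \<in> carrier R"
      using h Ac pvc x by auto
    have "(c \<otimes> x [^] d \<oplus> u) \<oplus> (e \<otimes> x [^] d \<oplus> v) = (c \<oplus> e) \<otimes> x [^] d \<oplus> (u \<oplus> v)"
      using cl by algebra
    then have "(c \<oplus> e) \<otimes> x [^] d \<oplus> (u \<oplus> v) \<in> J" using Ja[OF J h(5,6)] by simp
    then show "c \<oplus> e \<in> lead J d" unfolding lead_def using subringE(7)[OF A h(1,2)] pva[OF h(3,4)] by blast
  next
    fix r c assume r: "r \<in> A" and "c \<in> lead J d"
    then obtain u where h: "c \<in> A" "u \<in> poly_values R A x d" "c \<otimes> x [^] d \<oplus> u \<in> J"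
      unfolding lead_def by blast
    have cl: "c \<in> carrier R" "r \<in> carrier R" "u \<in> carrier R" "x [^] d \<in> carrier R"
      using h r Ac pvc x by auto
    have "r \<otimes> (c \<otimes> x [^] d \<oplus> u) = (r \<otimes> c) \<otimes> x [^] d \<oplus> r \<otimes> u" using cl by algebra
    moreover have "r \<otimes> (c \<otimes> x [^] d \<oplus> u) \<in> J" using Jm[OF J _ h(3)] r B(2) by blast
    moreover have "r \<otimes> u \<in> poly_values R A x d"
      by (rule poly_values_scale[OF Ac Ac x _ r h(2)]) (use subringE(6)[OF A] in blast)
    ultimately show "r \<otimes> c \<in> lead J d" unfolding lead_def using subringE(6)[OF A r h(1)] by auto
  qed
  have LT: "T \<subseteq> lead J d" if J: "J \<in> \<J>" for J d
  proof
    fix t assume t: "t \<in> T"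
    then have tc: "t \<in> carrier R" using TA Ac by blast
    have "x [^] d \<otimes> t \<in> J" using Jm[OF J powB] TJ[OF J] t by blast
    then have "t \<otimes> x [^] d \<oplus> \<zero> \<in> J" using tc x by (simp add: m_comm)
    then show "t \<in> lead J d" unfolding lead_def using pvz t TA by blast
  qed
  have Lmono: "lead J d \<subseteq> lead J' d" if "J \<subseteq> J'" for J J' d
    using that unfolding lead_def by blast
  have LSuc: "lead J d \<subseteq> lead J (Suc d)" if J: "J \<in> \<J>" for J d
  proof
    fix c assume "c \<in> lead J d"
    then obtain u where h: "c \<in> A" "u \<in> poly_values R A x d" "c \<otimes> x [^] d \<oplus> u \<in> J"
      unfolding lead_def by blast
    have cl: "c \<in> carrier R" "u \<in> carrier R" "x [^] d \<in> carrier R"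
      using h Ac pvc x by auto
    have "x \<otimes> (c \<otimes> x [^] d \<oplus> u) = c \<otimes> (x [^] d \<otimes> x) \<oplus> x \<otimes> u" using cl x by algebra
    then have "c \<otimes> x [^] Suc d \<oplus> x \<otimes> u \<in> J" using Jm[OF J B(3) h(3)] by simp
    moreover have "x \<otimes> u \<in> poly_values R A x (Suc d)"
      using poly_values_shift[OF Aa x h(2), of 1] x by simp
    ultimately show "c \<in> lead J (Suc d)" unfolding lead_def using h(1) by blast
  qed
  have Lle: "lead J d \<subseteq> lead J e" if "J \<in> \<J>" "d \<le> e" for J d e
    using lift_Suc_mono_le[of "lead J", OF LSuc[OF that(1)] that(2)] .
  have eqI: "J' = J" if J: "J \<in> \<J>" "J' \<in> \<J>" "J \<subseteq> J'" and L: "\<And>d. lead J' d = lead J d" for J J'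
  proof -
    have "u \<in> J" if "u \<in> poly_values R A x d" "u \<in> J'" for u d
      using that
    proof (induction d arbitrary: u)
      case 0
      then show ?case using Jz[OF J(1)] by simp
    next
      case (Suc d)
      then obtain v c where h: "v \<in> poly_values R A x d" "c \<in> A" "u = v \<oplus> c \<otimes> x [^] d" by auto
      have cl: "v \<in> carrier R" "c \<in> carrier R" "x [^] d \<in> carrier R" using h Ac pvc x by auto
      have "c \<otimes> x [^] d \<oplus> v \<in> J'" using Suc.prems(2) h(3) cl by (simp add: a_comm)
      then have "c \<in> lead J d" unfolding L[symmetric] using h(1,2) unfolding lead_def by blast
      then obtain w where w: "w \<in> poly_values R A x d" "c \<otimes> x [^] d \<oplus> w \<in> J" unfolding lead_def by blast
      have wc: "w \<in> carrier R" using w pvc by blast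
      have "u \<oplus> \<ominus> (c \<otimes> x [^] d \<oplus> w) \<in> J'"
        using Ja[OF J(2) Suc.prems(2) Jneg[OF J(2)]] w(2) J(3) by blast
      moreover have "u \<oplus> \<ominus> (c \<otimes> x [^] d \<oplus> w) = v \<oplus> \<ominus> w" unfolding h(3) using cl wc by algebra
      ultimately have "v \<oplus> \<ominus> w \<in> J" using Suc.IH[OF pva[OF h(1) pvn[OF w(1)]]] by simp
      then have "(v \<oplus> \<ominus> w) \<oplus> (c \<otimes> x [^] d \<oplus> w) \<in> J" using Ja[OF J(1) _ w(2)] by blast
      moreover have "(v \<oplus> \<ominus> w) \<oplus> (c \<otimes> x [^] d \<oplus> w) = u" unfolding h(3) using cl wc by algebra
      ultimately show ?case by simp
    qed
    then have "J' \<subseteq> J" using Jsub[OF J(2)] unfolding B_def adjoin_def by blast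
    then show ?thesis using J(3) by blast
  qed
  have maxL: "\<exists>J\<in>\<J>'. \<exists>d\<in>N. \<forall>J'\<in>\<J>'. \<forall>d'\<in>N. lead J d \<subseteq> lead J' d' \<longrightarrow> lead J' d' = lead J d"
    if ne: "J\<^sub>0 \<in> \<J>'" "d\<^sub>0 \<in> N" and sub: "\<J>' \<subseteq> \<J>" for J\<^sub>0 \<J>' d\<^sub>0 N
  proof -
    define \<L> where "\<L> = (\<lambda>(J, d). lead J d) ` (\<J>' \<times> N)"
    have L: "ideal L (R\<lparr>carrier := A\<rparr>) \<and> T \<subseteq> L" if "L \<in> \<L>" for L
      using that sub Lid LT unfolding \<L>_def by fast
    have "lead J\<^sub>0 d\<^sub>0 \<in> \<L>" unfolding \<L>_def using ne by auto
    then obtain M where M: "M \<in> \<L>" and max: "\<And>L. L \<in> \<L> \<Longrightarrow> M \<subseteq> L \<Longrightarrow> L = M"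
      by (rule noetherian_aboveE[OF noeth]) (use L in blast)+
    from M obtain J d where Jd: "J \<in> \<J>'" "d \<in> N" "M = lead J d" unfolding \<L>_def by auto
    show ?thesis
    proof (intro bexI[of _ J] bexI[of _ d] ballI impI)
      fix J' d' assume "J' \<in> \<J>'" "d' \<in> N" and le: "lead J d \<subseteq> lead J' d'"
      then have "lead J' d' \<in> \<L>" unfolding \<L>_def by auto
      then show "lead J' d' = lead J d" using max le Jd(3) by simp
    qed (use Jd in auto)
  qed
  obtain J\<^sub>0 where "J\<^sub>0 \<in> \<J>" using \<open>\<J> \<noteq> {}\<close> by blast
  then obtain J1 d1 where J1: "J1 \<in> \<J>"
    and max1: "\<And>J' d'. J' \<in> \<J> \<Longrightarrow> lead J1 d1 \<subseteq> lead J' d' \<Longrightarrow> lead J' d' = lead J1 d1"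
    using maxL[of J\<^sub>0 \<J> 0 UNIV] by blast
  have "\<exists>J\<in>\<J>. J1 \<subseteq> J \<and> (\<forall>J'\<in>\<J>. J \<subseteq> J' \<longrightarrow> (\<forall>d<m. lead J' d = lead J d))" for m
  proof (induction m)
    case 0
    show ?case using J1 by blast
  next
    case (Suc m)
    then obtain J where J: "J \<in> \<J>" "J1 \<subseteq> J"
      and Jmax: "\<forall>J'\<in>\<J>. J \<subseteq> J' \<longrightarrow> (\<forall>d<m. lead J' d = lead J d)" by blast
    obtain J2 where J2: "J2 \<in> \<J>" "J \<subseteq> J2"
      and J2max: "\<And>J'. J' \<in> \<J> \<Longrightarrow> J \<subseteq> J' \<Longrightarrow> lead J2 m \<subseteq> lead J' m \<Longrightarrow> lead J' m = lead J2 m"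
      using maxL[of J "{J' \<in> \<J>. J \<subseteq> J'}" m "{m}"] J by blast
    have "lead J' d = lead J2 d" if J': "J' \<in> \<J>" "J2 \<subseteq> J'" and d: "d < Suc m" for J' d
    proof (cases "d = m")
      case True
      then show ?thesis using J2max[OF J'(1)] J2(2) J'(2) Lmono[OF J'(2)] by blast
    next
      case False
      then show ?thesis using d Jmax J' J2 by simp
    qed
    then have max: "\<forall>J'\<in>\<J>. J2 \<subseteq> J' \<longrightarrow> (\<forall>d<Suc m. lead J' d = lead J2 d)" by simp
    have "J1 \<subseteq> J2" using J(2) J2(2) by (rule order_trans)
    show ?case
      by (rule bexI[of _ J2], rule conjI, fact, rule max, rule J2(1))
  qed
  from this[of d1] obtain J where J: "J \<in> \<J>" "J1 \<subseteq> J"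
    and Jmax: "\<forall>J'\<in>\<J>. J \<subseteq> J' \<longrightarrow> (\<forall>d<d1. lead J' d = lead J d)" by blast
  have top: "lead J' d = lead J1 d1" if "J' \<in> \<J>" "J1 \<subseteq> J'" "d1 \<le> d" for J' d
    using max1[OF that(1)] Lmono[OF that(2), of d1] Lle[OF that(1,3)] by blast
  have "J' = J" if J': "J' \<in> \<J>" "J \<subseteq> J'" for J'
  proof (rule eqI[OF J(1) J'])
    fix d show "lead J' d = lead J d"
      using Jmax[rule_format, OF J', of d] top[OF J'(1), of d] top[OF J, of d] J J'(2) by (cases "d < d1") auto
  qed
  then show "\<exists>M\<in>\<J>. \<forall>J\<in>\<J>. M \<subseteq> J \<longrightarrow> J = M" using J(1) by blast
qed

text \<open>
  The ring generated by a finite set is described by its universal property, so that no order of adjunction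
  has to be chosen.
\<close>

lemma Hilbert_basis_finite:
  assumes "finite Y" and "subring A R" and "noetherian_above (R\<lparr>carrier := A\<rparr>) T" and "T \<subseteq> A"
    and "Y \<subseteq> carrier R"
  shows "\<exists>B. subring B R \<and> A \<subseteq> B \<and> Y \<subseteq> B \<and> noetherian_above (R\<lparr>carrier := B\<rparr>) T \<and>
    (\<forall>C. subring C R \<and> A \<subseteq> C \<and> Y \<subseteq> C \<longrightarrow> B \<subseteq> C)"
  using assms(1,5)
proof (induction Y rule: finite_induct)
  case empty
  show ?case using assms by blast
next
  case (insert y Y)
  then have "Y \<subseteq> carrier R" by blast
  from insert.IH[OF this] obtain B where B: "subring B R" "A \<subseteq> B" "Y \<subseteq> B" "noetherian_above (R\<lparr>carrier := B\<rparr>) T"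
    and least: "\<forall>C. subring C R \<and> A \<subseteq> C \<and> Y \<subseteq> C \<longrightarrow> B \<subseteq> C" by blast
  have y: "y \<in> carrier R" using insert by blast
  have "noetherian_above (R\<lparr>carrier := adjoin R B y\<rparr>) T"
    using Hilbert_basis[OF B(1,4) _ y] B(2) assms(4) by blast
  moreover have "adjoin R B y \<subseteq> C" if "subring C R" "A \<subseteq> C" "insert y Y \<subseteq> C" for C
    using adjoin_least[OF that(1), of B y] least that by blast
  ultimately show ?case using adjoin_subring[OF B(1) y] B(2,3) by blast
qed

text \<open>
  An ideal of \<open>B\<close> is determined by its intersection with \<open>A\<close>, because every element of \<open>B\<close> becomes an
  element of \<open>A\<close> on multiplication by an element of \<open>A\<close> that is a unit of \<open>B\<close>.
\<close>

lemma noetherian_above_subring_of_quotients: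
  assumes A: "subring A R" and noeth: "noetherian_above (R\<lparr>carrier := A\<rparr>) T" and TA: "T \<subseteq> A"
    and B: "subring B R" and AB: "A \<subseteq> B"
    and frac: "\<And>x. x \<in> B \<Longrightarrow> \<exists>s\<in>A. \<exists>t\<in>B. t \<otimes> s = \<one> \<and> s \<otimes> x \<in> A"
  shows "noetherian_above (R\<lparr>carrier := B\<rparr>) T"
  unfolding noetherian_above_def
proof (intro allI impI)
  fix \<J> assume "\<J> \<noteq> {}" and id: "\<forall>J\<in>\<J>. ideal J (R\<lparr>carrier := B\<rparr>) \<and> T \<subseteq> J"
  have J: "J \<subseteq> B" "\<zero> \<in> J" "\<And>u v. u \<in> J \<Longrightarrow> v \<in> J \<Longrightarrow> u \<oplus> v \<in> J"
    "\<And>r u. r \<in> B \<Longrightarrow> u \<in> J \<Longrightarrow> r \<otimes> u \<in> J" "T \<subseteq> J" if "J \<in> \<J>" for J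
    using id[rule_format, OF that] unfolding ideal_subring_iff[OF B] by blast+
  have JA: "ideal (J \<inter> A) (R\<lparr>carrier := A\<rparr>)" "T \<subseteq> J \<inter> A" if "J \<in> \<J>" for J
  proof -
    show "ideal (J \<inter> A) (R\<lparr>carrier := A\<rparr>)" unfolding ideal_subring_iff[OF A]
      using J(2-4)[OF that] subringE(2,6,7)[OF A] AB by auto
    show "T \<subseteq> J \<inter> A" using J(5)[OF that] TA by blast
  qed
  obtain J\<^sub>0 where "J\<^sub>0 \<in> \<J>" using \<open>\<J> \<noteq> {}\<close> by blast
  then have "J\<^sub>0 \<inter> A \<in> (\<lambda>J. J \<inter> A) ` \<J>" by blast
  then obtain M where M: "M \<in> (\<lambda>J. J \<inter> A) ` \<J>"
    and max: "\<And>L. L \<in> (\<lambda>J. J \<inter> A) ` \<J> \<Longrightarrow> M \<subseteq> L \<Longrightarrow> L = M"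
    by (rule noetherian_aboveE[OF noeth]) (use JA in blast)+
  from M obtain J1 where J1: "J1 \<in> \<J>" "M = J1 \<inter> A" by blast
  have "J' = J1" if J': "J' \<in> \<J>" "J1 \<subseteq> J'" for J'
  proof
    show "J' \<subseteq> J1"
    proof
      fix x assume x: "x \<in> J'"
      then have xB: "x \<in> B" using J(1)[OF J'(1)] by blast
      then obtain s t where st: "s \<in> A" "t \<in> B" "t \<otimes> s = \<one>" "s \<otimes> x \<in> A" using frac by blast
      have "s \<otimes> x \<in> J' \<inter> A" using st J(4)[OF J'(1) _ x] AB by blast
      also have "J' \<inter> A = J1 \<inter> A" using max J' J1 by blast
      finally have "t \<otimes> (s \<otimes> x) \<in> J1" using J(4)[OF J1(1) st(2)] by blast
      moreover have "s \<in> carrier R" "t \<in> carrier R" "x \<in> carrier R"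
        using st xB subringE(1)[OF A] subringE(1)[OF B] by auto
      then have "t \<otimes> (s \<otimes> x) = x" using st(3) by (simp add: m_assoc[symmetric])
      ultimately show "x \<in> J1" by simp
    qed
  qed (rule J'(2))
  then show "\<exists>M\<in>\<J>. \<forall>J\<in>\<J>. M \<subseteq> J \<longrightarrow> J = M" using J1(1) by blast
qed

end

section \<open>Localisation at a prime and Chevalley extension\<close>

text \<open>
  The localisation of \<open>M \<subseteq> A\<close> at the prime \<open>P\<close> of \<open>A\<close>, realised inside the field \<open>R\<close>. For \<open>M = A\<close> it is
  the local ring \<open>A\<^sub>P\<close>, for a prime \<open>M \<subseteq> P\<close> it is the prime of \<open>A\<^sub>P\<close> that extends \<open>M\<close>. Clearing a
  denominator instead of dividing by it keeps inverses out of the closure proofs.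
\<close>

definition localisation :: "('a, 'm) ring_scheme \<Rightarrow> 'a set \<Rightarrow> 'a set \<Rightarrow> 'a set \<Rightarrow> 'a set" where
  "localisation R A P M = {x \<in> carrier R. \<exists>s\<in>A - P. s \<otimes>\<^bsub>R\<^esub> x \<in> M}"

context field
begin

lemma nonzero_inv:
  assumes "x \<in> carrier R" and "x \<noteq> \<zero>"
  shows "inv x \<in> carrier R" and "inv x \<noteq> \<zero>" and "inv x \<otimes> x = \<one>" and "x \<otimes> inv x = \<one>"
    and "inv (inv x) = x"
proof -
  have u: "x \<in> Units R" using assms field_Units by simp
  then show "inv x \<in> carrier R" "inv x \<otimes> x = \<one>" "x \<otimes> inv x = \<one>" "inv (inv x) = x"
    by simp_all
  show "inv x \<noteq> \<zero>" using u assms(1) by (metis Units_r_inv r_null zero_not_one)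
qed

lemma primeideal_subringE:
  assumes "subring A R" and "primeideal P (R\<lparr>carrier := A\<rparr>)"
  shows "P \<subseteq> A" and "\<zero> \<in> P" and "\<one> \<notin> P"
    and "\<And>x y. x \<in> P \<Longrightarrow> y \<in> P \<Longrightarrow> x \<oplus> y \<in> P"
    and "\<And>r x. r \<in> A \<Longrightarrow> x \<in> P \<Longrightarrow> r \<otimes> x \<in> P"
    and "\<And>x y. x \<in> A \<Longrightarrow> y \<in> A \<Longrightarrow> x \<notin> P \<Longrightarrow> y \<notin> P \<Longrightarrow> x \<otimes> y \<notin> P"
  using assms(2) unfolding primeideal_subring_iff[OF assms(1)] ideal_subring_iff[OF assms(1)]
  by blast+

lemma localisation_common_denominator:
  assumes A: "subring A R" and P: "primeideal P (R\<lparr>carrier := A\<rparr>)"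
    and Q: "\<And>r x. r \<in> A \<Longrightarrow> x \<in> Q \<Longrightarrow> r \<otimes> x \<in> Q"
    and x: "x \<in> localisation R A P Q" and y: "y \<in> localisation R A P Q"
  obtains s where "s \<in> A - P" and "s \<otimes> x \<in> Q" and "s \<otimes> y \<in> Q"
proof -
  note Ac = subringE(1)[OF A]
  from x y obtain s t where st: "s \<in> A - P" "s \<otimes> x \<in> Q" "t \<in> A - P" "t \<otimes> y \<in> Q"
    and c: "x \<in> carrier R" "y \<in> carrier R" unfolding localisation_def by blast
  have stc: "s \<in> carrier R" "t \<in> carrier R" using st Ac by auto
  have "(s \<otimes> t) \<otimes> x = t \<otimes> (s \<otimes> x)" "(s \<otimes> t) \<otimes> y = s \<otimes> (t \<otimes> y)"
    using stc c by (simp_all add: m_ac)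
  moreover have "s \<otimes> t \<in> A - P"
    using st subringE(6)[OF A] primeideal_subringE(6)[OF A P] by blast
  ultimately show thesis using that[of "s \<otimes> t"] Q st by auto
qed

lemma subset_localisation:
  assumes A: "subring A R" and P: "primeideal P (R\<lparr>carrier := A\<rparr>)" and Q: "Q \<subseteq> A"
  shows "Q \<subseteq> localisation R A P Q"
proof
  fix x assume x: "x \<in> Q"
  have "\<one> \<in> A - P" using subringE(3)[OF A] primeideal_subringE(3)[OF A P] by blast
  moreover have xc: "x \<in> carrier R" using x Q subringE(1)[OF A] by blast
  moreover have "\<one> \<otimes> x \<in> Q" using x xc by simp
  ultimately show "x \<in> localisation R A P Q" unfolding localisation_def by blast
qed

lemma localisation_subring:
  assumes A: "subring A R" and P: "primeideal P (R\<lparr>carrier := A\<rparr>)"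
  shows "subring (localisation R A P A) R" and "A \<subseteq> localisation R A P A"
    and "\<And>s. s \<in> A - P \<Longrightarrow> s \<noteq> \<zero> \<and> inv s \<in> localisation R A P A"
proof -
  note Ac = subringE(1)[OF A]
  show A_sub: "A \<subseteq> localisation R A P A"
    by (rule subset_localisation[OF A P order_refl])
  show "subring (localisation R A P A) R"
  proof (rule subringI)
    show "localisation R A P A \<subseteq> carrier R" unfolding localisation_def by blast
    show "\<one> \<in> localisation R A P A" using A_sub subringE(3)[OF A] by blast
  next
    fix x assume "x \<in> localisation R A P A"
    then obtain s where s: "x \<in> carrier R" "s \<in> A - P" "s \<otimes> x \<in> A" unfolding localisation_def by blast
    have "s \<otimes> (\<ominus> x) = \<ominus> (s \<otimes> x)" using s Ac by (simp add: r_minus subset_iff)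
    then have "s \<otimes> (\<ominus> x) \<in> A" using s subringE(5)[OF A] by simp
    then show "\<ominus> x \<in> localisation R A P A" unfolding localisation_def using s(1,2) a_inv_closed by blast
  next
    fix x y assume "x \<in> localisation R A P A" "y \<in> localisation R A P A"
    then obtain s t where st: "s \<in> A - P" "s \<otimes> x \<in> A" "t \<in> A - P" "t \<otimes> y \<in> A"
      and c: "x \<in> carrier R" "y \<in> carrier R" unfolding localisation_def by blast
    have stc: "s \<in> carrier R" "t \<in> carrier R" using st Ac by auto
    have stA: "s \<otimes> t \<in> A - P"
      using st subringE(6)[OF A] primeideal_subringE(6)[OF A P] by blast
    have "(s \<otimes> t) \<otimes> (x \<otimes> y) = (s \<otimes> x) \<otimes> (t \<otimes> y)" using stc c by (simp add: m_ac)
    then have "(s \<otimes> t) \<otimes> (x \<otimes> y) \<in> A" using st subringE(6)[OF A] by simp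
    then show "x \<otimes> y \<in> localisation R A P A" unfolding localisation_def using c stA by blast
    have "(s \<otimes> t) \<otimes> (x \<oplus> y) = t \<otimes> (s \<otimes> x) \<oplus> s \<otimes> (t \<otimes> y)" using stc c by algebra
    then have "(s \<otimes> t) \<otimes> (x \<oplus> y) \<in> A" using st subringE(6,7)[OF A] by simp
    then show "x \<oplus> y \<in> localisation R A P A" unfolding localisation_def using c stA by blast
  qed
  fix s assume s: "s \<in> A - P"
  have sc: "s \<in> carrier R" using s Ac by blast
  have s0: "s \<noteq> \<zero>" using s primeideal_subringE(2)[OF A P] by blast
  have "s \<otimes> inv s \<in> A" using nonzero_inv(4)[OF sc s0] subringE(3)[OF A] by simp
  then show "s \<noteq> \<zero> \<and> inv s \<in> localisation R A P A"
    unfolding localisation_def using s0 s nonzero_inv(1)[OF sc s0] by blast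
qed

lemma primeideal_localisation:
  assumes A: "subring A R" and P: "primeideal P (R\<lparr>carrier := A\<rparr>)"
    and Q: "primeideal Q (R\<lparr>carrier := A\<rparr>)" and QP: "Q \<subseteq> P"
  shows "primeideal (localisation R A P Q) (R\<lparr>carrier := localisation R A P A\<rparr>)"
    and "localisation R A P Q \<inter> A = Q"
proof -
  note Ac = subringE(1)[OF A] and Q' = primeideal_subringE[OF A Q]
  note F = localisation_subring[OF A P]
  show contr: "localisation R A P Q \<inter> A = Q"
  proof
    show "localisation R A P Q \<inter> A \<subseteq> Q"
      unfolding localisation_def using Q'(6) QP by blast
    show "Q \<subseteq> localisation R A P Q \<inter> A"
      using subset_localisation[OF A P Q'(1)] Q'(1) by blast
  qed
  show "primeideal (localisation R A P Q) (R\<lparr>carrier := localisation R A P A\<rparr>)"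
    unfolding primeideal_subring_iff[OF F(1)] ideal_subring_iff[OF F(1)]
  proof (intro conjI ballI impI)
    show "localisation R A P Q \<subseteq> localisation R A P A"
      unfolding localisation_def using Q'(1) by blast
    show "\<zero> \<in> localisation R A P Q" "\<one> \<notin> localisation R A P Q"
      using contr Q'(2,3) subringE(3)[OF A] by blast+
  next
    fix x y assume xy: "x \<in> localisation R A P Q" "y \<in> localisation R A P Q"
    obtain s where s: "s \<in> A - P" "s \<otimes> x \<in> Q" "s \<otimes> y \<in> Q"
      by (rule localisation_common_denominator[OF A P _ xy]) (use Q'(5) in blast)+
    have c: "x \<in> carrier R" "y \<in> carrier R" "s \<in> carrier R"
      using xy s Ac unfolding localisation_def by auto
    have "s \<otimes> (x \<oplus> y) \<in> Q" using Q'(4)[OF s(2,3)] c by (simp add: r_distr)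
    then show "x \<oplus> y \<in> localisation R A P Q" unfolding localisation_def using s(1) c by blast
  next
    fix r x assume "r \<in> localisation R A P A" "x \<in> localisation R A P Q"
    then obtain s t where st: "s \<in> A - P" "s \<otimes> r \<in> A" "t \<in> A - P" "t \<otimes> x \<in> Q"
      and c: "r \<in> carrier R" "x \<in> carrier R" unfolding localisation_def by blast
    have stc: "s \<in> carrier R" "t \<in> carrier R" using st Ac by auto
    have stA: "s \<otimes> t \<in> A - P"
      using st subringE(6)[OF A] primeideal_subringE(6)[OF A P] by blast
    have "(s \<otimes> t) \<otimes> (r \<otimes> x) = (s \<otimes> r) \<otimes> (t \<otimes> x)" using stc c by (simp add: m_ac)
    then have "(s \<otimes> t) \<otimes> (r \<otimes> x) \<in> Q" using Q'(5) st by simp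
    then show "r \<otimes> x \<in> localisation R A P Q" unfolding localisation_def using c stA by blast
  next
    fix x y assume "x \<in> localisation R A P A" "y \<in> localisation R A P A" "x \<otimes> y \<in> localisation R A P Q"
    then obtain s t r where st: "s \<in> A - P" "s \<otimes> x \<in> A" "t \<in> A - P" "t \<otimes> y \<in> A"
      "r \<in> A - P" "r \<otimes> (x \<otimes> y) \<in> Q"
      and c: "x \<in> carrier R" "y \<in> carrier R" unfolding localisation_def by blast
    have stc: "s \<in> carrier R" "t \<in> carrier R" "r \<in> carrier R" using st Ac by auto
    have "r \<otimes> ((s \<otimes> x) \<otimes> (t \<otimes> y)) = (s \<otimes> t) \<otimes> (r \<otimes> (x \<otimes> y))" using stc c by (simp add: m_ac)
    then have "r \<otimes> ((s \<otimes> x) \<otimes> (t \<otimes> y)) \<in> Q" using Q'(5) st subringE(6)[OF A] by auto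
    then have "s \<otimes> x \<in> Q \<or> t \<otimes> y \<in> Q"
      using Q'(6) st QP subringE(6)[OF A] by (meson DiffD1 DiffD2 subsetD)
    then show "x \<in> localisation R A P Q \<or> y \<in> localisation R A P Q"
      unfolding localisation_def using st c by blast
  qed
qed

text \<open>
  The ring \<open>A\<^sub>P / P A\<^sub>P\<close> is a field: every ideal of \<open>A\<^sub>P\<close> that contains \<open>P\<close> is either \<open>P A\<^sub>P\<close> or \<open>A\<^sub>P\<close>.
\<close>

lemma noetherian_above_localisation:
  assumes A: "subring A R" and P: "primeideal P (R\<lparr>carrier := A\<rparr>)"
  shows "noetherian_above (R\<lparr>carrier := localisation R A P A\<rparr>) P"
proof -
  note Ac = subringE(1)[OF A] and P' = primeideal_subringE[OF A P]
  note F = localisation_subring[OF A P]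
  have dich: "J = localisation R A P A \<or> J = localisation R A P P"
    if "ideal J (R\<lparr>carrier := localisation R A P A\<rparr>)" and PJ: "P \<subseteq> J" for J
  proof -
    have J: "J \<subseteq> localisation R A P A" "\<And>r u. r \<in> localisation R A P A \<Longrightarrow> u \<in> J \<Longrightarrow> r \<otimes> u \<in> J"
      using that(1) unfolding ideal_subring_iff[OF F(1)] by blast+
    have div: "x \<in> J" if x: "x \<in> carrier R" "s \<in> A - P" "s \<otimes> x \<in> J" for x s
    proof -
      have s: "s \<in> carrier R" "s \<noteq> \<zero>" "inv s \<in> localisation R A P A" using F(3)[OF x(2)] x(2) Ac by auto
      have "inv s \<otimes> (s \<otimes> x) \<in> J" using J(2)[OF s(3) x(3)] .
      then show ?thesis using x s nonzero_inv[OF s(1,2)] by (simp add: m_assoc[symmetric])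
    qed
    show ?thesis
    proof (cases "J \<subseteq> localisation R A P P")
      case True
      have "localisation R A P P \<subseteq> J" unfolding localisation_def using div PJ by blast
      then show ?thesis using True by blast
    next
      case False
      then obtain x where x: "x \<in> J" "x \<notin> localisation R A P P" by blast
      then obtain s where s: "x \<in> carrier R" "s \<in> A - P" "s \<otimes> x \<in> A"
        using J(1) unfolding localisation_def by blast
      have "s \<otimes> x \<in> A - P" using s x(2) unfolding localisation_def by blast
      moreover have "s \<otimes> x \<in> J" using J(2) x(1) s(2) F(2) by blast
      then have "(s \<otimes> x) \<otimes> \<one> \<in> J" using s Ac by auto
      ultimately have one: "\<one> \<in> J" using div[OF one_closed] by blast
      have "r \<in> J" if "r \<in> localisation R A P A" for r
        using J(2)[OF that one] that unfolding localisation_def by auto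
      then show ?thesis using J(1) by blast
    qed
  qed
  show ?thesis unfolding noetherian_above_def
  proof (intro allI impI)
    fix \<J> assume "\<J> \<noteq> {}" and id: "\<forall>J\<in>\<J>. ideal J (R\<lparr>carrier := localisation R A P A\<rparr>) \<and> P \<subseteq> J"
    then obtain J\<^sub>0 where J0: "J\<^sub>0 \<in> \<J>" by blast
    have two: "J = localisation R A P A \<or> J = localisation R A P P" if "J \<in> \<J>" for J
      using dich id that by blast
    show "\<exists>M\<in>\<J>. \<forall>J\<in>\<J>. M \<subseteq> J \<longrightarrow> J = M"
    proof (cases "localisation R A P A \<in> \<J>")
      case True
      have "localisation R A P P \<subseteq> localisation R A P A"
        unfolding localisation_def using P'(1) by blast
      then show ?thesis using True two by blast
    next
      case False
      then show ?thesis using J0 two by blast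
    qed
  qed
qed

text \<open>
  The step that makes two relations \<open>1 = f(x)\<close> and \<open>1 = g(1/x)\<close> with coefficients in \<open>M\<close> contradict the
  minimality of their degrees. If \<open>c\<close> is the constant coefficient of \<open>g\<close>, then \<open>(1 - c) x\<^sup>n\<close> is a
  combination of lower powers of \<open>x\<close>; since \<open>1 - c\<close> has an inverse that maps \<open>M\<close> into \<open>M\<close>, the
  leading term of \<open>f\<close> can be replaced.
\<close>

lemma degree_reduction:
  assumes M: "additive_subgroup M R" and x: "x \<in> carrier R" and w: "w \<in> carrier R" "x \<otimes> w = \<one>"
    and "\<one> \<notin> M"
    and unit: "\<And>c. c \<in> M \<Longrightarrow> \<exists>v\<in>carrier R. v \<otimes> (\<one> \<ominus> c) = \<one> \<and> (\<forall>y\<in>M. v \<otimes> y \<in> M)"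
    and MM: "\<And>y z. y \<in> M \<Longrightarrow> z \<in> M \<Longrightarrow> y \<otimes> z \<in> M"
    and px: "\<one> \<in> poly_values R M x (Suc n)" and pw: "\<one> \<in> poly_values R M w (Suc m)"
    and mn: "m \<le> n"
  shows "\<one> \<in> poly_values R M x n"
proof -
  interpret M: additive_subgroup M R by (rule M)
  note pvc = poly_values_closed[OF M.a_subset]
  interpret U: additive_subgroup "poly_values R M x n" R
    by (rule poly_values_additive_subgroup[OF M x])
  have "n \<noteq> 0"
  proof
    assume "n = 0"
    with px obtain c where "c \<in> M" "\<one> = \<zero> \<oplus> c \<otimes> \<one>" by auto
    then show False using \<open>\<one> \<notin> M\<close> M.a_subset by (metis l_zero m_closed one_closed r_one subsetD)
  qed
  then obtain k where k: "n = Suc k" using not0_implies_Suc by blast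
  obtain c u where cu: "c \<in> M" "u \<in> poly_values R M w m" "\<one> = c \<oplus> w \<otimes> u"
    using poly_values_Horner[OF M w(1) pw] by blast
  have cl: "c \<in> carrier R" "u \<in> carrier R" "x [^] k \<in> carrier R" using cu M.a_subset pvc[OF w(1), of m] x by auto
  have y: "x [^] k \<otimes> u \<in> poly_values R M x n"
    using poly_values_reverse[OF M x w cu(2), of k] mn k by simp
  obtain v where v: "v \<in> carrier R" "v \<otimes> (\<one> \<ominus> c) = \<one>" "\<And>y. y \<in> M \<Longrightarrow> v \<otimes> y \<in> M"
    using unit[OF cu(1)] by blast
  have "\<one> \<ominus> c = (c \<oplus> w \<otimes> u) \<ominus> c" using cu(3) by simp
  also have "\<dots> = w \<otimes> u" using cl w by algebra
  finally have wu: "\<one> \<ominus> c = w \<otimes> u" .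
  have "x [^] n = v \<otimes> (\<one> \<ominus> c) \<otimes> x [^] n" using v x by simp
  also have "\<dots> = v \<otimes> (w \<otimes> u) \<otimes> (x [^] k \<otimes> x)" unfolding wu k by simp
  also have "\<dots> = v \<otimes> ((x \<otimes> w) \<otimes> (x [^] k \<otimes> u))" using cl v(1) w(1) x by (simp add: m_ac)
  also have "\<dots> = v \<otimes> (x [^] k \<otimes> u)" using w cl by simp
  finally have xn: "x [^] n = v \<otimes> (x [^] k \<otimes> u)" .
  have "x [^] n \<in> poly_values R M x n" unfolding xn
    by (rule poly_values_scale[of "{v}" M, OF _ M.a_subset x _ _ y]) (use v in auto)
  from px obtain d p where dp: "d \<in> M" "p \<in> poly_values R M x n" "\<one> = p \<oplus> d \<otimes> x [^] n" by auto
  have "d \<otimes> x [^] n \<in> poly_values R M x n"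
    by (rule poly_values_scale[OF M.a_subset M.a_subset x _ dp(1)]) (use MM \<open>x [^] n \<in> _\<close> in auto)
  then show ?thesis using U.a_closed[OF dp(2)] dp(3) by simp
qed

lemma valuation_ringI:
  assumes W: "subring W R" and val: "\<And>x. x \<in> carrier R \<Longrightarrow> x \<noteq> \<zero> \<Longrightarrow> x \<in> W \<or> inv x \<in> W"
  shows "valuation_ring_of R W"
  unfolding valuation_ring_of_def quotient_field_def
proof (intro conjI ballI)
  show "field R" by (rule field_axioms)
  show "subdomain W R" using subdomainI'[OF W] .
  fix x assume x: "x \<in> carrier R"
  have one: "\<one> \<in> W" "\<one> \<in> W - {\<zero>}" using subringE(3)[OF W] by auto
  show "\<exists>a\<in>W. \<exists>b\<in>W - {\<zero>}. x = a \<otimes> inv b"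
  proof (cases "x \<in> W")
    case True
    then show ?thesis using x one by (intro bexI[of _ x] bexI[of _ \<one>]) auto
  next
    case False
    then have x0: "x \<noteq> \<zero>" using subringE(2)[OF W] by blast
    then have "inv x \<in> W - {\<zero>}" using val[OF x] False nonzero_inv[OF x] by blast
    moreover have "x = \<one> \<otimes> inv (inv x)" using nonzero_inv[OF x x0] x by simp
    ultimately show ?thesis using one by blast
  qed
qed (use val in auto)

lemma valuation_ringD:
  assumes "valuation_ring_of R W"
  shows "subring W R" and "\<And>x. x \<in> carrier R \<Longrightarrow> x \<noteq> \<zero> \<Longrightarrow> x \<in> W \<or> inv x \<in> W"
  using assms unfolding valuation_ring_of_def quotient_field_def
  using subdomain.axioms(1) subcring.axioms(1) by blast+

text \<open>
  Chevalley's extension theorem: a proper ideal \<open>I\<close> of \<open>A\<close> consists of nonunits of some valuation ring that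
  contains \<open>A\<close>. Zorn's lemma is applied to a single set \<open>M\<close>, which will consist of nonunits, and the ring is
  recovered as \<open>W = {x. x M \<subseteq> M}\<close>; this avoids a partial order on pairs of a ring and an ideal. The
  admissible \<open>M\<close> are additively and multiplicatively closed \<open>A\<close>-submodules that contain \<open>I\<close> but not \<open>\<one>\<close>.
  If \<open>x \<notin> W\<close>, the polynomials in \<open>x\<close> with coefficients in a maximal \<open>M\<close> form a larger such set unless they
  take the value \<open>\<one>\<close>; if this happens for both \<open>x\<close> and \<open>inv x\<close>, then \<open>degree_reduction\<close> applies.
\<close>

theorem Chevalley:
  assumes A: "subring A R" and I: "ideal I (R\<lparr>carrier := A\<rparr>)" and one: "\<one> \<notin> I"
  shows "\<exists>W. valuation_ring_of R W \<and> A \<subseteq> W \<and> (\<forall>x\<in>I. x \<noteq> \<zero> \<longrightarrow> inv x \<notin> W)"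
proof -
  note Ac = subringE(1)[OF A]
  have I': "I \<subseteq> A" "\<zero> \<in> I" "\<And>x y. x \<in> I \<Longrightarrow> y \<in> I \<Longrightarrow> x \<oplus> y \<in> I"
    "\<And>r x. r \<in> A \<Longrightarrow> x \<in> I \<Longrightarrow> r \<otimes> x \<in> I"
    using I unfolding ideal_subring_iff[OF A] by blast+
  define adm where "adm M \<longleftrightarrow> M \<subseteq> carrier R \<and> I \<subseteq> M \<and> \<one> \<notin> M \<and>
    (\<forall>x\<in>M. \<forall>y\<in>M. x \<oplus> y \<in> M \<and> x \<otimes> y \<in> M) \<and> (\<forall>a\<in>A. \<forall>x\<in>M. a \<otimes> x \<in> M)" for M
  have "\<exists>M\<in>Collect adm. \<forall>X\<in>Collect adm. M \<subseteq> X \<longrightarrow> X = M"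
  proof (rule subset_Zorn_nonempty)
    have "adm I" unfolding adm_def using I' Ac one by blast
    then show "Collect adm \<noteq> {}" by blast
  next
    fix C assume C: "C \<noteq> {}" "subset.chain (Collect adm) C"
    have adm: "adm M" if "M \<in> C" for M using C(2) that unfolding subset.chain_def by blast
    have common: "\<exists>M\<in>C. x \<in> M \<and> y \<in> M" if "x \<in> \<Union>C" "y \<in> \<Union>C" for x y
      using that C(2) unfolding subset.chain_def by blast
    show "\<Union>C \<in> Collect adm" unfolding mem_Collect_eq adm_def
    proof (intro conjI ballI)
      show "\<Union>C \<subseteq> carrier R" "\<one> \<notin> \<Union>C" using adm unfolding adm_def by blast+
      show "I \<subseteq> \<Union>C" using adm C(1) unfolding adm_def by blast
      fix x y assume "x \<in> \<Union>C" "y \<in> \<Union>C"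
      then obtain M where "M \<in> C" "x \<in> M" "y \<in> M" using common by blast
      then show "x \<oplus> y \<in> \<Union>C" "x \<otimes> y \<in> \<Union>C" using adm[of M] unfolding adm_def by blast+
    next
      fix a x assume "a \<in> A" "x \<in> \<Union>C"
      then show "a \<otimes> x \<in> \<Union>C" using adm unfolding adm_def by blast
    qed
  qed
  then obtain M where "adm M" and max: "\<And>X. adm X \<Longrightarrow> M \<subseteq> X \<Longrightarrow> X = M" by blast
  then have Mc: "M \<subseteq> carrier R" and IM: "I \<subseteq> M" and oneM: "\<one> \<notin> M"
    and Ma: "\<And>x y. x \<in> M \<Longrightarrow> y \<in> M \<Longrightarrow> x \<oplus> y \<in> M"
    and Mm: "\<And>x y. x \<in> M \<Longrightarrow> y \<in> M \<Longrightarrow> x \<otimes> y \<in> M"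
    and AM: "\<And>a x. a \<in> A \<Longrightarrow> x \<in> M \<Longrightarrow> a \<otimes> x \<in> M" unfolding adm_def by blast+
  have M0: "\<zero> \<in> M" using IM I'(2) by blast
  have M: "additive_subgroup M R"
  proof (rule additive_subgroupI_cring[OF Mc M0 Ma])
    fix x assume x: "x \<in> M"
    have "\<ominus> \<one> \<otimes> x \<in> M" using AM x subringE(3,5)[OF A] by blast
    then show "\<ominus> x \<in> M" using x Mc by (simp add: l_minus subset_iff)
  qed
  interpret M: additive_subgroup M R by (rule M)
  define W where "W = {x \<in> carrier R. \<forall>y\<in>M. x \<otimes> y \<in> M}"
  have W: "subring W R"
  proof (rule subringI)
    fix x assume "x \<in> W"
    then show "\<ominus> x \<in> W" unfolding W_def using Mc M.a_inv_closed by (auto simp: l_minus subset_iff)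
  next
    fix x y assume "x \<in> W" "y \<in> W"
    then have c: "x \<in> carrier R" "y \<in> carrier R" and
      xM: "\<And>z. z \<in> M \<Longrightarrow> x \<otimes> z \<in> M" and yM: "\<And>z. z \<in> M \<Longrightarrow> y \<otimes> z \<in> M" unfolding W_def by blast+
    have "(x \<otimes> y) \<otimes> z \<in> M" if "z \<in> M" for z
      using xM[OF yM[OF that]] c that Mc by (simp add: m_assoc subset_iff)
    then show "x \<otimes> y \<in> W" unfolding W_def using c by blast
    have "(x \<oplus> y) \<otimes> z \<in> M" if "z \<in> M" for z
      using Ma[OF xM[OF that] yM[OF that]] c that Mc by (simp add: l_distr subset_iff)
    then show "x \<oplus> y \<in> W" unfolding W_def using c by blast
  qed (use Mc in \<open>auto simp: W_def\<close>)
  have AW: "A \<subseteq> W" unfolding W_def using AM Ac by blast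
  have MW: "M \<subseteq> W" unfolding W_def using Mm Mc by blast
  have unit: "\<exists>v\<in>carrier R. v \<otimes> (\<one> \<ominus> c) = \<one> \<and> (\<forall>y\<in>M. v \<otimes> y \<in> M)" if c: "c \<in> M" for c
  proof -
    have cc: "c \<in> carrier R" using c Mc by blast
    define u where "u = \<one> \<ominus> c"
    have uc: "u \<in> carrier R" unfolding u_def using cc by simp
    have "u \<noteq> \<zero>"
    proof
      assume "u = \<zero>"
      have "\<one> = u \<oplus> c" unfolding u_def using cc by algebra
      then have "\<one> = c" using \<open>u = \<zero>\<close> cc by simp
      then show False using c oneM by blast
    qed
    have upow: "\<exists>d\<in>M. u [^] j = \<one> \<ominus> d" for j :: nat
    proof (induction j)
      case 0
      have "\<one> = \<one> \<ominus> \<zero>" by algebra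
      then show ?case using M0 by auto
    next
      case (Suc j)
      then obtain d where d: "d \<in> M" "u [^] j = \<one> \<ominus> d" by blast
      have dc: "d \<in> carrier R" using d Mc by blast
      have "(\<one> \<ominus> d) \<otimes> (\<one> \<ominus> c) = \<one> \<ominus> (d \<oplus> c \<oplus> \<ominus> (d \<otimes> c))" using dc cc by algebra
      moreover have "d \<oplus> c \<oplus> \<ominus> (d \<otimes> c) \<in> M"
        using Ma[OF Ma[OF d(1) c] M.a_inv_closed[OF Mm[OF d(1) c]]] .
      ultimately show ?case using d(2) u_def by auto
    qed
    have uM: "u \<otimes> y \<in> M" if y: "y \<in> M" for y
    proof -
      have "y \<in> carrier R" using y Mc by blast
      then have "u \<otimes> y = y \<oplus> \<ominus> (c \<otimes> y)" unfolding u_def using cc by algebra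
      then show ?thesis using y c Ma Mm M.a_inv_closed by simp
    qed
    have ujM: "u [^] j \<otimes> y \<in> M" if y: "y \<in> M" for y and j :: nat
    proof (induction j)
      case 0
      show ?case using y Mc by auto
    next
      case (Suc j)
      have "u [^] Suc j \<otimes> y = u \<otimes> (u [^] j \<otimes> y)" using y Mc uc by (simp add: m_ac subset_iff)
      then show ?case using uM[OF Suc] by simp
    qed
    \<comment> \<open>Dividing \<open>M\<close> by all powers of \<open>u\<close> gives an admissible set, so nothing new is obtained.\<close>
    define N where "N = {x \<in> carrier R. \<exists>j::nat. u [^] j \<otimes> x \<in> M}"
    have "adm N" unfolding adm_def
    proof (intro conjI ballI)
      show "N \<subseteq> carrier R" unfolding N_def by blast
      show "\<one> \<notin> N"
      proof
        assume "\<one> \<in> N"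
        then obtain j :: nat where "u [^] j \<in> M" unfolding N_def using uc by auto
        moreover obtain d where d: "d \<in> M" "u [^] j = \<one> \<ominus> d" using upow by blast
        ultimately have "(\<one> \<ominus> d) \<oplus> d \<in> M" using Ma by simp
        moreover have "d \<in> carrier R" using d Mc by blast
        then have "(\<one> \<ominus> d) \<oplus> d = \<one>" by algebra
        ultimately show False using oneM by simp
      qed
      show "I \<subseteq> N"
      proof
        fix x assume "x \<in> I"
        then have "x \<in> M" "x \<in> carrier R" using IM Mc by auto
        then show "x \<in> N" unfolding N_def by (auto intro!: exI[of _ "0::nat"])
      qed
    next
      fix x y assume "x \<in> N" "y \<in> N"
      then obtain j k :: nat where h: "x \<in> carrier R" "y \<in> carrier R" "u [^] j \<otimes> x \<in> M" "u [^] k \<otimes> y \<in> M"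
        unfolding N_def by blast
      have uj: "u [^] j \<in> carrier R" "u [^] k \<in> carrier R" using uc by auto
      have "u [^] (j + k) \<otimes> (x \<otimes> y) = (u [^] j \<otimes> x) \<otimes> (u [^] k \<otimes> y)"
        unfolding nat_pow_mult[OF uc, symmetric] using uj h by (simp add: m_ac)
      then have "u [^] (j + k) \<otimes> (x \<otimes> y) \<in> M" using Mm[OF h(3,4)] by simp
      then show "x \<otimes> y \<in> N" unfolding N_def using h by blast
      have "u [^] (j + k) \<otimes> (x \<oplus> y) = u [^] k \<otimes> (u [^] j \<otimes> x) \<oplus> u [^] j \<otimes> (u [^] k \<otimes> y)"
        unfolding nat_pow_mult[OF uc, symmetric] using uj h by algebra
      then have "u [^] (j + k) \<otimes> (x \<oplus> y) \<in> M" using Ma ujM h by simp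
      then show "x \<oplus> y \<in> N" unfolding N_def using h by blast
    next
      fix a x assume a: "a \<in> A" and "x \<in> N"
      then obtain j :: nat where h: "x \<in> carrier R" "u [^] j \<otimes> x \<in> M" unfolding N_def by blast
      have "u [^] j \<in> carrier R" "a \<in> carrier R" using uc a Ac by auto
      then have "u [^] j \<otimes> (a \<otimes> x) = a \<otimes> (u [^] j \<otimes> x)" using h by (simp add: m_ac)
      then have "u [^] j \<otimes> (a \<otimes> x) \<in> M" using AM a h by simp
      then show "a \<otimes> x \<in> N" unfolding N_def using h a Ac by blast
    qed
    moreover have "M \<subseteq> N"
    proof
      fix x assume "x \<in> M"
      then show "x \<in> N" unfolding N_def using Mc by (auto intro!: exI[of _ "0::nat"])
    qed
    ultimately have "N = M" by (rule max)
    have i: "inv u \<in> carrier R" "inv u \<otimes> u = \<one>" using nonzero_inv[OF uc \<open>u \<noteq> \<zero>\<close>] by auto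
    have "inv u \<otimes> y \<in> M" if y: "y \<in> M" for y
    proof -
      have yc: "y \<in> carrier R" using y Mc by blast
      have "u [^] (1::nat) \<otimes> (inv u \<otimes> y) = (inv u \<otimes> u) \<otimes> y" using uc i(1) yc by (simp add: m_ac)
      then have "u [^] (1::nat) \<otimes> (inv u \<otimes> y) \<in> M" using i yc y by simp
      then have "inv u \<otimes> y \<in> N" unfolding N_def using i(1) yc by blast
      then show ?thesis using \<open>N = M\<close> by simp
    qed
    then show ?thesis using i u_def by blast
  qed
  have ext: "\<exists>n. \<one> \<in> poly_values R M x n" if x: "x \<in> carrier R" "x \<notin> W" for x
  proof (rule ccontr)
    assume "\<not> (\<exists>n. \<one> \<in> poly_values R M x n)"
    then have no: "\<one> \<notin> adjoin R M x" unfolding adjoin_def by blast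
    interpret X: additive_subgroup "adjoin R M x" R by (rule adjoin_additive_subgroup[OF M x(1)])
    have MX: "M \<subseteq> adjoin R M x" by (rule subset_adjoin[OF Mc x(1)])
    have "adm (adjoin R M x)" unfolding adm_def
    proof (intro conjI ballI)
      show "adjoin R M x \<subseteq> carrier R" by (rule X.a_subset)
      show "I \<subseteq> adjoin R M x" using IM MX by blast
      show "\<one> \<notin> adjoin R M x" by (rule no)
      show "u \<oplus> v \<in> adjoin R M x" if "u \<in> adjoin R M x" "v \<in> adjoin R M x" for u v
        using that X.a_closed by blast
      show "u \<otimes> v \<in> adjoin R M x" if uv: "u \<in> adjoin R M x" "v \<in> adjoin R M x" for u v
        by (rule adjoin_mult[OF M M x(1) _ uv]) (use Mm in blast)
      show "a \<otimes> u \<in> adjoin R M x" if a: "a \<in> A" and u: "u \<in> adjoin R M x" for a u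
      proof -
        from u obtain d where d: "u \<in> poly_values R M x d" unfolding adjoin_def by blast
        have "a \<otimes> u \<in> poly_values R M x d"
          by (rule poly_values_scale[OF Ac Mc x(1) _ a d]) (use AM in blast)
        then show ?thesis unfolding adjoin_def by blast
      qed
    qed
    then have eq: "adjoin R M x = M" using max MX by blast
    have "x \<otimes> y \<in> M" if "y \<in> M" for y
      using adjoin_mult_var[OF M x(1), of y] that unfolding eq by blast
    then have "x \<in> W" unfolding W_def using x(1) by blast
    then show False using x(2) by blast
  qed
  have "x \<in> W \<or> inv x \<in> W" if x: "x \<in> carrier R" "x \<noteq> \<zero>" for x
  proof (rule ccontr)
    assume "\<not> (x \<in> W \<or> inv x \<in> W)"
    then have no: "x \<notin> W" "inv x \<notin> W" by auto
    note i = nonzero_inv[OF x]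
    define n where "n = (LEAST n. \<one> \<in> poly_values R M x n)"
    define m where "m = (LEAST n. \<one> \<in> poly_values R M (inv x) n)"
    have n: "\<one> \<in> poly_values R M x n" unfolding n_def by (rule LeastI_ex[OF ext[OF x(1) no(1)]])
    have m: "\<one> \<in> poly_values R M (inv x) m" unfolding m_def by (rule LeastI_ex[OF ext[OF i(1) no(2)]])
    have nl: "n \<le> k" if "\<one> \<in> poly_values R M x k" for k unfolding n_def using that by (rule Least_le)
    have ml: "m \<le> k" if "\<one> \<in> poly_values R M (inv x) k" for k unfolding m_def using that by (rule Least_le)
    obtain n' m' where n': "n = Suc n'" "m = Suc m'"
      using n m by (cases n; cases m) auto
    show False
    proof (cases "m' \<le> n'")
      case True
      have "\<one> \<in> poly_values R M x n'"
        by (rule degree_reduction[OF M x(1) i(1,4) oneM _ _ n[unfolded n'] m[unfolded n'] True])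
          (use unit Mm in blast)+
      then show False using nl[of n'] n' by simp
    next
      case False
      then have le: "n' \<le> m'" by simp
      have "\<one> \<in> poly_values R M (inv x) m'"
        by (rule degree_reduction[OF M i(1) x(1) i(3) oneM _ _ m[unfolded n'] n[unfolded n'] le])
          (use unit Mm in blast)+
      then show False using ml[of m'] n' by simp
    qed
  qed
  then have "valuation_ring_of R W" using valuation_ringI[OF W] by blast
  moreover have "inv x \<notin> W" if x: "x \<in> I" "x \<noteq> \<zero>" for x
  proof
    assume "inv x \<in> W"
    then have "inv x \<otimes> x \<in> M" using x IM unfolding W_def by blast
    moreover have "x \<in> carrier R" using x I' Ac by blast
    then have "inv x \<otimes> x = \<one>" using nonzero_inv x by blast
    ultimately show False using oneM by simp
  qed
  ultimately show ?thesis using AW by blast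
qed

end

section \<open>Valuation rings determined by the elements of a subring that they make nonunits\<close>

context field
begin

text \<open>
  A valuation ring is local: its nonunits form an ideal.
\<close>

lemma valuation_nonunits_ideal:
  assumes V: "valuation_ring_of R V"
  shows "ideal {x \<in> V. x \<noteq> \<zero> \<longrightarrow> inv x \<notin> V} (R\<lparr>carrier := V\<rparr>)"
proof -
  note S = valuation_ringD(1)[OF V] and val = valuation_ringD(2)[OF V]
  note Vc = subringE(1)[OF S]
  define N where "N = {x \<in> V. x \<noteq> \<zero> \<longrightarrow> inv x \<notin> V}"
  have mult: "r \<otimes> x \<in> N" if r: "r \<in> V" and x: "x \<in> N" for r x
  proof (rule ccontr)
    assume "r \<otimes> x \<notin> N"
    moreover have xV: "x \<in> V" "r \<otimes> x \<in> V" using x r subringE(6)[OF S] unfolding N_def by auto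
    ultimately have nz: "r \<otimes> x \<noteq> \<zero>" "inv (r \<otimes> x) \<in> V" unfolding N_def by auto
    have c: "r \<in> carrier R" "x \<in> carrier R" "r \<otimes> x \<in> carrier R" using r xV Vc by auto
    have x0: "x \<noteq> \<zero>" using nz c by auto
    note i = nonzero_inv[OF c(3) nz(1)] and ix = nonzero_inv[OF c(2) x0]
    have "(inv (r \<otimes> x) \<otimes> r) \<otimes> x = \<one>" using i c by (simp add: m_assoc)
    moreover have "(inv (r \<otimes> x) \<otimes> r) \<otimes> x \<otimes> inv x = inv (r \<otimes> x) \<otimes> r"
      using i(1) ix c by (simp add: m_assoc)
    ultimately have "inv x = inv (r \<otimes> x) \<otimes> r" using ix by simp
    then have "inv x \<in> V" using nz(2) r subringE(6)[OF S] by simp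
    then show False using x x0 unfolding N_def by blast
  qed
  have NV: "N \<subseteq> V" unfolding N_def by blast
  \<comment> \<open>For nonzero \<open>x\<close> and \<open>y\<close>, one of \<open>y / x\<close> and \<open>x / y\<close> lies in \<open>V\<close>; by symmetry the first case suffices.\<close>
  have half: "x \<oplus> y \<in> N" if xy: "x \<in> N" "y \<in> N" and x0: "x \<noteq> \<zero>" and q: "y \<otimes> inv x \<in> V" for x y
  proof -
    have c: "x \<in> carrier R" "y \<in> carrier R" using xy NV Vc by auto
    note ix = nonzero_inv[OF c(1) x0]
    have "(\<one> \<oplus> y \<otimes> inv x) \<otimes> x = x \<oplus> y \<otimes> (inv x \<otimes> x)" using c ix(1) by algebra
    then have "(\<one> \<oplus> y \<otimes> inv x) \<otimes> x = x \<oplus> y" using ix c by simp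
    moreover have "\<one> \<oplus> y \<otimes> inv x \<in> V" using q subringE(3,7)[OF S] by blast
    ultimately show ?thesis using mult xy(1) by metis
  qed
  have add: "x \<oplus> y \<in> N" if xy: "x \<in> N" "y \<in> N" for x y
  proof (cases "x = \<zero> \<or> y = \<zero>")
    case True
    then show ?thesis using xy NV Vc by auto
  next
    case False
    have c: "x \<in> carrier R" "y \<in> carrier R" using xy NV Vc by auto
    note ix = nonzero_inv[of x] and iy = nonzero_inv[of y]
    have nz: "y \<otimes> inv x \<noteq> \<zero>" using False c ix iy by (simp add: integral_iff)
    have "(x \<otimes> inv y) \<otimes> (y \<otimes> inv x) = (x \<otimes> inv x) \<otimes> (inv y \<otimes> y)" using c ix(1) iy(1) False by (simp add: m_ac)
    then have "(x \<otimes> inv y) \<otimes> (y \<otimes> inv x) = \<one>" using c ix iy False by simp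
    then have "inv (y \<otimes> inv x) = x \<otimes> inv y" using c ix(1) iy(1) False
      by (intro comm_inv_char) (simp_all add: m_comm)
    then have "y \<otimes> inv x \<in> V \<or> x \<otimes> inv y \<in> V" using val[of "y \<otimes> inv x"] nz c ix(1) False by auto
    then show ?thesis using half[OF xy] half[OF xy(2,1)] False c a_comm by auto
  qed
  have "ideal N (R\<lparr>carrier := V\<rparr>)" unfolding ideal_subring_iff[OF S]
    using NV mult add subringE(2)[OF S] unfolding N_def by auto
  then show ?thesis unfolding N_def .
qed

text \<open>
  The hypothesis \<open>uniq\<close> says that \<open>V\<close> is the only valuation ring containing \<open>A\<close> in which every element of
  \<open>A\<close> that is a nonunit of \<open>V\<close> is a nonunit. Let \<open>w = inv z\<close>. The ideal \<open>I\<close> of \<open>A[w]\<close> generated by these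
  elements and \<open>w\<close> must contain \<open>\<one>\<close>: otherwise Chevalley's theorem yields a valuation ring in which they are
  nonunits, this ring is \<open>V\<close>, and \<open>z = inv w\<close> is not in \<open>V\<close>. The resulting equation \<open>1 = i + w r\<close>,
  multiplied by a power of \<open>z\<close>, has the leading coefficient \<open>1 - i\<close>, a unit of \<open>V\<close>.
\<close>

lemma unit_leading_coefficient:
  assumes V: "valuation_ring_of R V" and A: "subring A R" and AV: "A \<subseteq> V"
    and uniq: "\<And>W. valuation_ring_of R W \<Longrightarrow> A \<subseteq> W \<Longrightarrow>
      (\<And>x. x \<in> A \<Longrightarrow> x \<noteq> \<zero> \<Longrightarrow> inv x \<notin> V \<Longrightarrow> inv x \<notin> W) \<Longrightarrow> W = V"
    and z: "z \<in> V" "z \<noteq> \<zero>"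
  shows "\<exists>d. \<exists>c\<in>A. c \<noteq> \<zero> \<and> inv c \<in> V \<and> c \<otimes> z [^] d \<in> poly_values R A z d"
proof -
  note S = valuation_ringD(1)[OF V]
  note Vc = subringE(1)[OF S] and Ac = subringE(1)[OF A] and Aa = subring_additive_subgroup[OF A]
  define N where "N = {x \<in> V. x \<noteq> \<zero> \<longrightarrow> inv x \<notin> V}"
  have N: "N \<subseteq> V" "\<zero> \<in> N" "\<And>x y. x \<in> N \<Longrightarrow> y \<in> N \<Longrightarrow> x \<oplus> y \<in> N"
    "\<And>r x. r \<in> V \<Longrightarrow> x \<in> N \<Longrightarrow> r \<otimes> x \<in> N"
    using valuation_nonunits_ideal[OF V] unfolding N_def[symmetric] ideal_subring_iff[OF S] by blast+
  have oneN: "\<one> \<notin> N" unfolding N_def using subringE(3)[OF S] by simp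
  have zc: "z \<in> carrier R" using z Vc by blast
  define w where "w = inv z"
  have w: "w \<in> carrier R" "w \<noteq> \<zero>" "w \<otimes> z = \<one>" "z \<otimes> w = \<one>" "inv w = z"
    unfolding w_def using nonzero_inv[OF zc z(2)] by auto
  define B where "B = adjoin R A w"
  note B = adjoin_subring[OF A w(1), folded B_def]
  note Bc = subringE(1)[OF B(1)]
  define I where "I = {i \<oplus> w \<otimes> r | i r. i \<in> N \<inter> A \<and> r \<in> B}"
  have idI: "ideal I (R\<lparr>carrier := B\<rparr>)" unfolding ideal_subring_iff[OF B(1)]
  proof (intro conjI ballI)
    show "I \<subseteq> B" unfolding I_def using B subringE(6,7)[OF B(1)] by blast
    have "\<zero> = \<zero> \<oplus> w \<otimes> \<zero>" using w by simp
    then show "\<zero> \<in> I" unfolding I_def using N(2) subringE(2)[OF A] subringE(2)[OF B(1)] by blast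
  next
    fix x y assume "x \<in> I" "y \<in> I"
    then obtain i r j s where h: "x = i \<oplus> w \<otimes> r" "y = j \<oplus> w \<otimes> s" "i \<in> N" "i \<in> A" "j \<in> N" "j \<in> A"
      "r \<in> B" "s \<in> B" unfolding I_def by blast
    have c: "i \<in> carrier R" "j \<in> carrier R" "r \<in> carrier R" "s \<in> carrier R" using h Ac Bc by auto
    have "x \<oplus> y = (i \<oplus> j) \<oplus> w \<otimes> (r \<oplus> s)" unfolding h(1,2) using c w(1) by algebra
    moreover have "i \<oplus> j \<in> N \<inter> A" "r \<oplus> s \<in> B" using h N(3) subringE(7)[OF A] subringE(7)[OF B(1)] by auto
    ultimately show "x \<oplus> y \<in> I" unfolding I_def by blast
  next
    fix s x assume s: "s \<in> B" and "x \<in> I"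
    then obtain i r where h: "x = i \<oplus> w \<otimes> r" "i \<in> N" "i \<in> A" "r \<in> B" unfolding I_def by blast
    obtain d where "s \<in> poly_values R A w d" using s unfolding B_def adjoin_def by blast
    then have "s \<in> poly_values R A w (Suc d)" using poly_values_mono[OF Aa w(1) le_SucI[OF order_refl]] by blast
    then obtain e t where et: "e \<in> A" "t \<in> poly_values R A w d" "s = e \<oplus> w \<otimes> t"
      using poly_values_Horner[OF Aa w(1)] by blast
    have t: "t \<in> B" using et(2) unfolding B_def adjoin_def by blast
    have c: "i \<in> carrier R" "e \<in> carrier R" "r \<in> carrier R" "t \<in> carrier R" "s \<in> carrier R"
      using h et t s Ac Bc by auto
    have "s \<otimes> x = s \<otimes> i \<oplus> w \<otimes> (s \<otimes> r)" unfolding h(1) using c w(1) by algebra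
    also have "s \<otimes> i = e \<otimes> i \<oplus> w \<otimes> (t \<otimes> i)" unfolding et(3) using c w(1) by algebra
    also have "(e \<otimes> i \<oplus> w \<otimes> (t \<otimes> i)) \<oplus> w \<otimes> (s \<otimes> r) = e \<otimes> i \<oplus> w \<otimes> (t \<otimes> i \<oplus> s \<otimes> r)"
      using c w(1) by algebra
    finally have "s \<otimes> x = e \<otimes> i \<oplus> w \<otimes> (t \<otimes> i \<oplus> s \<otimes> r)" .
    moreover have "e \<otimes> i \<in> N \<inter> A" using N(4) h et AV subringE(6)[OF A] by blast
    moreover have "t \<otimes> i \<oplus> s \<otimes> r \<in> B"
      using subringE(7)[OF B(1) subringE(6)[OF B(1) t subsetD[OF B(2) h(3)]]
          subringE(6)[OF B(1) s h(4)]] .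
    ultimately show "s \<otimes> x \<in> I" unfolding I_def by blast
  qed
  have "\<one> \<in> I"
  proof (rule ccontr)
    assume "\<one> \<notin> I"
    then obtain W where W: "valuation_ring_of R W" "B \<subseteq> W" "\<And>x. x \<in> I \<Longrightarrow> x \<noteq> \<zero> \<Longrightarrow> inv x \<notin> W"
      using Chevalley[OF B(1) idI] by blast
    have "W = V"
    proof (rule uniq[OF W(1)])
      show "A \<subseteq> W" using B(2) W(2) by blast
      fix x assume x: "x \<in> A" "x \<noteq> \<zero>" "inv x \<notin> V"
      then have "x \<in> N \<inter> A" unfolding N_def using AV by blast
      moreover have "x = x \<oplus> w \<otimes> \<zero>" using x Ac w by auto
      ultimately have "x \<in> I" unfolding I_def using subringE(2)[OF B(1)] by blast
      then show "inv x \<notin> W" using W(3) x(2) by blast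
    qed
    have "w = \<zero> \<oplus> w \<otimes> \<one>" using w by simp
    then have "w \<in> I" unfolding I_def using N(2) subringE(2)[OF A] subringE(3)[OF B(1)] by blast
    then have "z \<notin> W" using W(3) w by auto
    then show False using \<open>W = V\<close> z by blast
  qed
  then obtain i r where ir: "\<one> = i \<oplus> w \<otimes> r" "i \<in> N" "i \<in> A" "r \<in> B" unfolding I_def by blast
  have c: "i \<in> carrier R" "r \<in> carrier R" using ir Ac Bc by auto
  define e where "e = \<one> \<ominus> i"
  have e: "e \<in> A" unfolding e_def a_minus_def
    using subringE(3)[OF A] subringE(5)[OF A ir(3)] subringE(7)[OF A] by blast
  have "e \<notin> N"
  proof
    assume "e \<in> N"
    then have "e \<oplus> i \<in> N" using N(3) ir by blast
    moreover have "e \<oplus> i = \<one>" unfolding e_def using c by algebra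
    ultimately show False using oneN by simp
  qed
  then have eu: "e \<noteq> \<zero>" "inv e \<in> V" using e AV unfolding N_def by auto
  have "e = (i \<oplus> w \<otimes> r) \<ominus> i" unfolding e_def using ir(1) by simp
  also have "\<dots> = w \<otimes> r" using c w(1) by algebra
  finally have ewr: "e = w \<otimes> r" .
  obtain n where "r \<in> poly_values R A w n" using ir(4) unfolding B_def adjoin_def by blast
  then have "z [^] n \<otimes> r \<in> poly_values R A z (Suc n)"
    using poly_values_reverse[OF Aa zc w(1,4), of r n n] by simp
  moreover have "e \<otimes> z [^] Suc n = (w \<otimes> z) \<otimes> (z [^] n \<otimes> r)"
    unfolding ewr using w(1) zc c by (simp add: m_ac)
  then have "e \<otimes> z [^] Suc n = z [^] n \<otimes> r" using w zc c by simp
  ultimately have "e \<otimes> z [^] Suc n \<in> poly_values R A z (Suc n)" by simp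
  then show ?thesis using e eu by blast
qed

text \<open>
  If \<open>Q\<close> and \<open>Q'\<close> agree on \<open>A\<close>, all coefficients of a polynomial over \<open>A\<close> whose value at \<open>z \<in> Q' - Q\<close> lies in
  \<open>Q\<close> are in \<open>Q\<close>. By Horner's scheme the value is \<open>e + z t\<close>, so the constant coefficient \<open>e\<close> is in \<open>Q'\<close>, hence
  in \<open>Q\<close>; then \<open>z t \<in> Q\<close>, so \<open>t \<in> Q\<close>, and \<open>t\<close> is the value of a polynomial of smaller degree with
  the same leading coefficient.
\<close>

lemma leading_coefficient_in_prime:
  assumes V: "subring V R" and AV: "A \<subseteq> V" and z: "z \<in> Q' - Q"
    and Q: "primeideal Q (R\<lparr>carrier := V\<rparr>)" and Q': "primeideal Q' (R\<lparr>carrier := V\<rparr>)"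
    and QQ': "Q \<subseteq> Q'" and contr: "A \<inter> Q' \<subseteq> Q" and c: "c \<in> A" and A: "additive_subgroup A R"
  shows "u \<in> poly_values R A z d \<Longrightarrow> u \<oplus> c \<otimes> z [^] d \<in> Q \<Longrightarrow> c \<in> Q"
proof (induction d arbitrary: u)
  case 0
  interpret A: additive_subgroup A R by (rule A)
  have "c \<in> carrier R" using c A.a_subset by blast
  then show ?case using 0 by simp
next
  case (Suc d)
  note q = primeideal_subringE[OF V Q] and q' = primeideal_subringE[OF V Q']
  note Vc = subringE(1)[OF V]
  have zV: "z \<in> V" and zc: "z \<in> carrier R" using z q'(1) Vc by auto
  obtain e v where ev: "e \<in> A" "v \<in> poly_values R A z d" "u = e \<oplus> z \<otimes> v"
    using poly_values_Horner[OF A zc Suc.prems(1)] by blast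
  have zpow: "z [^] k \<in> V" for k :: nat by (induction k) (use zV subringE[OF V] in auto)
  have vV: "v \<in> V" using ev(2) adjoin_least[OF V AV zV] unfolding adjoin_def by blast
  have cl: "e \<in> carrier R" "v \<in> carrier R" "c \<in> carrier R" "z [^] d \<in> carrier R"
    using ev(1) vV c AV Vc zpow by blast+
  define t where "t = v \<oplus> c \<otimes> z [^] d"
  have tV: "t \<in> V" unfolding t_def using vV c AV zpow subringE(6,7)[OF V] by blast
  have tc: "t \<in> carrier R" using tV Vc by blast
  have "u \<oplus> c \<otimes> (z [^] d \<otimes> z) = e \<oplus> z \<otimes> t" unfolding ev(3) t_def using cl zc by algebra
  then have et: "e \<oplus> z \<otimes> t \<in> Q" using Suc.prems(2) by simp
  have neg: "\<ominus> x \<in> P" if "x \<in> P" "primeideal P (R\<lparr>carrier := V\<rparr>)" for x P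
  proof -
    have "\<ominus> \<one> \<otimes> x \<in> P" using primeideal_subringE(5)[OF V that(2) _ that(1)] subringE(3,5)[OF V] by blast
    moreover have "x \<in> carrier R" using that primeideal_subringE(1)[OF V that(2)] Vc by blast
    ultimately show ?thesis by (simp add: l_minus)
  qed
  have "t \<otimes> z \<in> Q'" using q'(5)[OF tV] z by blast
  then have zt: "z \<otimes> t \<in> Q'" using tc zc by (simp add: m_comm)
  have "(e \<oplus> z \<otimes> t) \<oplus> \<ominus> (z \<otimes> t) \<in> Q'" using q'(4) et QQ' neg[OF zt Q'] by blast
  moreover have "(e \<oplus> z \<otimes> t) \<oplus> \<ominus> (z \<otimes> t) = e" using cl zc tc by algebra
  ultimately have eQ: "e \<in> Q" using contr ev(1) by auto
  have "\<ominus> e \<oplus> (e \<oplus> z \<otimes> t) \<in> Q" using q(4) et neg[OF eQ Q] by blast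
  moreover have "\<ominus> e \<oplus> (e \<oplus> z \<otimes> t) = z \<otimes> t" using cl zc tc by algebra
  ultimately have "t \<in> Q" using q(6)[OF zV tV] z by auto
  then show ?case using Suc.IH[OF ev(2)] unfolding t_def by blast
qed

text \<open>
  The incomparability theorem for integral extensions: the leading coefficient of the equation from
  \<open>unit_leading_coefficient\<close> is a unit of \<open>V\<close> and thus not in \<open>Q\<close>.
\<close>

lemma incomparability:
  assumes V: "valuation_ring_of R V" and A: "subring A R" and AV: "A \<subseteq> V"
    and uniq: "\<And>W. valuation_ring_of R W \<Longrightarrow> A \<subseteq> W \<Longrightarrow>
      (\<And>x. x \<in> A \<Longrightarrow> x \<noteq> \<zero> \<Longrightarrow> inv x \<notin> V \<Longrightarrow> inv x \<notin> W) \<Longrightarrow> W = V"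
    and Q: "primeideal Q (R\<lparr>carrier := V\<rparr>)" and Q': "primeideal Q' (R\<lparr>carrier := V\<rparr>)"
    and QQ': "Q \<subset> Q'"
  shows "\<exists>b\<in>A. b \<in> Q' \<and> b \<notin> Q"
proof (rule ccontr)
  assume "\<not> (\<exists>b\<in>A. b \<in> Q' \<and> b \<notin> Q)"
  then have contr: "A \<inter> Q' \<subseteq> Q" by blast
  note S = valuation_ringD(1)[OF V]
  note q = primeideal_subringE[OF S Q] and q' = primeideal_subringE[OF S Q']
  note Vc = subringE(1)[OF S] and Aa = subring_additive_subgroup[OF A]
  from QQ' obtain z where z: "z \<in> Q' - Q" by blast
  then have zV: "z \<in> V" "z \<noteq> \<zero>" using q(2) q'(1) by auto
  obtain d e where de: "e \<in> A" "e \<noteq> \<zero>" "inv e \<in> V" "e \<otimes> z [^] (d::nat) \<in> poly_values R A z d"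
    using unit_leading_coefficient[OF V A AV uniq zV] by blast
  have cl: "e \<in> carrier R" "z \<in> carrier R" using de zV AV Vc by auto
  interpret U: additive_subgroup "poly_values R A z d" R
    by (rule poly_values_additive_subgroup[OF Aa cl(2)])
  have "\<ominus> (e \<otimes> z [^] d) \<oplus> e \<otimes> z [^] d = \<zero>" using cl by (simp add: l_neg)
  then have "\<ominus> (e \<otimes> z [^] d) \<oplus> e \<otimes> z [^] d \<in> Q" using q(2) by simp
  then have "e \<in> Q"
    using leading_coefficient_in_prime[OF S AV z Q Q' _ contr de(1) Aa U.a_inv_closed[OF de(4)]] QQ' by blast
  then have "inv e \<otimes> e \<in> Q" using q(5) de(3) by blast
  then show False using nonzero_inv[OF cl(1) de(2)] q(3) by simp
qed

text \<open>
  Used for \<open>z = g / b\<close> with \<open>g \<in> A\<close>: an equation for \<open>z\<close> of degree \<open>d\<close>, multiplied by \<open>b\<^sup>d\<close>, shows that its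
  leading coefficient times \<open>g\<^sup>d\<close> is a multiple of \<open>b\<close> in \<open>A\<close>.
\<close>

lemma clear_denominator:
  assumes A: "subring A R" and b: "b \<in> A" and z: "z \<in> carrier R" and bz: "b \<otimes> z \<in> A"
  shows "u \<in> poly_values R A z d \<Longrightarrow> \<exists>a\<in>A. b [^] d \<otimes> u = b \<otimes> a"
proof (induction d arbitrary: u)
  case 0
  have "b \<in> carrier R" using b subringE(1)[OF A] by blast
  then have "b [^] (0::nat) \<otimes> u = b \<otimes> \<zero>" using 0 by simp
  then show ?case using subringE(2)[OF A] by blast
next
  case (Suc d)
  note Ac = subringE(1)[OF A]
  obtain v c where h: "v \<in> poly_values R A z d" "c \<in> A" "u = v \<oplus> c \<otimes> z [^] d"
    using Suc.prems by auto
  obtain a where a: "a \<in> A" "b [^] d \<otimes> v = b \<otimes> a" using Suc.IH[OF h(1)] by blast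
  have pow: "x [^] k \<in> A" if "x \<in> A" for x and k :: nat
    by (induction k) (use that subringE[OF A] in auto)
  have cl: "b \<in> carrier R" "a \<in> carrier R" "c \<in> carrier R" "v \<in> carrier R" "z [^] d \<in> carrier R"
    "b [^] d \<in> carrier R"
    using a b h Ac z poly_values_closed[OF Ac z, of d] by auto
  have "b [^] Suc d \<otimes> u = b \<otimes> (b [^] d \<otimes> v \<oplus> c \<otimes> (b [^] d \<otimes> z [^] d))"
    unfolding h nat_pow_Suc using cl by algebra
  also have "b [^] d \<otimes> z [^] d = (b \<otimes> z) [^] d" using cl z by (simp add: nat_pow_distrib)
  finally have "b [^] Suc d \<otimes> u = b \<otimes> (b \<otimes> a \<oplus> c \<otimes> (b \<otimes> z) [^] d)" unfolding a(2) .
  moreover have "b \<otimes> a \<oplus> c \<otimes> (b \<otimes> z) [^] d \<in> A"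
    using subringE(7)[OF A subringE(6)[OF A b a(1)] subringE(6)[OF A h(2) pow[OF bz]]] .
  ultimately show ?case by blast
qed

lemma quotient_in_valuation:
  assumes V: "valuation_ring_of R V" and x: "x \<in> V" and y: "y \<in> V"
  shows "(\<exists>t\<in>V. y = x \<otimes> t) \<or> (\<exists>t\<in>V. x = y \<otimes> t)"
proof (cases "x = \<zero> \<or> y = \<zero>")
  case True
  note S = valuation_ringD(1)[OF V]
  have "x \<in> carrier R" "y \<in> carrier R" using x y subringE(1)[OF S] by auto
  then show ?thesis using True subringE(2)[OF S] r_null by metis
next
  case False
  note S = valuation_ringD(1)[OF V] and val = valuation_ringD(2)[OF V]
  have c: "x \<in> carrier R" "y \<in> carrier R" using x y subringE(1)[OF S] by auto
  have ix: "inv x \<in> carrier R" "inv x \<otimes> x = \<one>" "x \<otimes> inv x = \<one>" "inv x \<noteq> \<zero>"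
    and iy: "inv y \<in> carrier R" "inv y \<otimes> y = \<one>" "y \<otimes> inv y = \<one>"
    using nonzero_inv[of x] nonzero_inv[of y] False c by auto
  define t where "t = y \<otimes> inv x"
  have t: "t \<in> carrier R" "t \<noteq> \<zero>" using c ix False by (auto simp: t_def integral_iff)
  have "x \<otimes> t = y \<otimes> (x \<otimes> inv x)" unfolding t_def using c ix(1) by (simp add: m_lcomm)
  then have yxt: "y = x \<otimes> t" using c ix by simp
  note it = nonzero_inv[OF t]
  have "y \<otimes> inv t = x \<otimes> (t \<otimes> inv t)" unfolding yxt using c t it(1) by (simp add: m_assoc)
  then have "x = y \<otimes> inv t" using it c by simp
  then show ?thesis using val[OF t] yxt by blast
qed

lemma valuation_primes_chain:
  assumes V: "valuation_ring_of R V"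
    and Q: "primeideal Q (R\<lparr>carrier := V\<rparr>)" and Q': "primeideal Q' (R\<lparr>carrier := V\<rparr>)"
  shows "Q \<subseteq> Q' \<or> Q' \<subseteq> Q"
proof (rule ccontr)
  assume "\<not> (Q \<subseteq> Q' \<or> Q' \<subseteq> Q)"
  then obtain x y where xy: "x \<in> Q" "x \<notin> Q'" "y \<in> Q'" "y \<notin> Q" by blast
  note S = valuation_ringD(1)[OF V]
  note q = primeideal_subringE[OF S Q] and q' = primeideal_subringE[OF S Q']
  have V': "x \<in> V" "y \<in> V" using xy q(1) q'(1) by auto
  have c: "t \<otimes> x = x \<otimes> t" "t \<otimes> y = y \<otimes> t" if "t \<in> V" for t
    using m_comm that V' subringE(1)[OF S] by (auto simp: subset_iff)
  show False using quotient_in_valuation[OF V V'] q(5) q'(5) xy c by metis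
qed

text \<open>
  Divisibility is a total preorder on a valuation ring, so the radical of \<open>bV\<close> is the least prime that contains
  \<open>b\<close>, and every prime without \<open>b\<close> lies below it.
\<close>

lemma radical_of_principal_prime:
  assumes V: "valuation_ring_of R V" and Q: "primeideal Q (R\<lparr>carrier := V\<rparr>)" and b: "b \<in> Q"
  defines "N \<equiv> {x \<in> V. \<exists>e::nat. \<exists>v\<in>V. x [^] e = b \<otimes> v}"
  shows "primeideal N (R\<lparr>carrier := V\<rparr>)" and "N \<subseteq> Q" and "b \<in> N"
    and "\<And>P. primeideal P (R\<lparr>carrier := V\<rparr>) \<Longrightarrow> b \<notin> P \<Longrightarrow> P \<subseteq> N"
proof -
  note S = valuation_ringD(1)[OF V]
  note q = primeideal_subringE[OF S Q] and Vc = subringE(1)[OF S]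
  have bV: "b \<in> V" and bc: "b \<in> carrier R" using b q(1) Vc by auto
  have pow: "x [^] k \<in> V" if "x \<in> V" for x and k :: nat
    by (induction k) (use that subringE[OF S] in auto)
  have powQ: "x [^] k \<notin> Q" if "x \<in> V" "x \<notin> Q" for x and k :: nat
  proof (induction k)
    case (Suc k)
    then show ?case using q(6)[OF pow[OF that(1)] that(1)] that(2) by simp
  qed (use q(3) in simp)
  have bQ: "b \<otimes> v \<in> Q" if "v \<in> V" for v
    using q(5)[OF that b] m_comm[OF bc, of v] that Vc by auto
  show NQ: "N \<subseteq> Q"
  proof
    fix x assume "x \<in> N"
    then obtain e :: nat and v where "x \<in> V" "v \<in> V" "x [^] e = b \<otimes> v" unfolding N_def by blast
    then show "x \<in> Q" using powQ[of x e] bQ[of v] by auto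
  qed
  have "b [^] (1::nat) = b \<otimes> \<one>" using bc by simp
  then show bN: "b \<in> N" unfolding N_def using bV subringE(3)[OF S] by blast
  have mult: "r \<otimes> x \<in> N" if r: "r \<in> V" and x: "x \<in> N" for r x
  proof -
    from x obtain e :: nat and v where h: "x \<in> V" "v \<in> V" "x [^] e = b \<otimes> v" unfolding N_def by blast
    have c: "r \<in> carrier R" "x \<in> carrier R" "v \<in> carrier R" "r [^] e \<in> carrier R"
      using r h Vc by auto
    have "(r \<otimes> x) [^] e = r [^] e \<otimes> (b \<otimes> v)" using c h(3) by (simp add: nat_pow_distrib)
    also have "\<dots> = b \<otimes> (r [^] e \<otimes> v)" using c bc by (simp add: m_lcomm)
    finally show ?thesis unfolding N_def using r h pow[OF r] subringE(6)[OF S] by blast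
  qed
  have comm: "x \<otimes> y = y \<otimes> x" if "x \<in> V" "y \<in> V" for x y using m_comm that Vc by blast
  have NV: "N \<subseteq> V" unfolding N_def by blast
  have half: "x \<oplus> x \<otimes> t \<in> N" if x: "x \<in> N" and t: "t \<in> V" for x t
  proof -
    have "x \<in> carrier R" "t \<in> carrier R" using x t NV Vc by auto
    then have "x \<oplus> x \<otimes> t = (\<one> \<oplus> t) \<otimes> x" by algebra
    then show ?thesis using mult[OF _ x, of "\<one> \<oplus> t"] t subringE(3,7)[OF S] by auto
  qed
  \<comment> \<open>Squaring absorbs the smaller factor: \<open>y * y = (x * y) * t\<close> when \<open>y = x * t\<close>.\<close>
  have root: "x \<otimes> t \<in> N" if x: "x \<in> V" and t: "t \<in> V" and xy: "x \<otimes> (x \<otimes> t) \<in> N" for x t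
  proof -
    have c: "x \<in> carrier R" "t \<in> carrier R" using x t Vc by auto
    have "t \<otimes> (x \<otimes> (x \<otimes> t)) \<in> N" by (rule mult[OF t xy])
    moreover have "t \<otimes> (x \<otimes> (x \<otimes> t)) = (x \<otimes> t) [^] (2::nat)"
      using c by (simp add: numeral_2_eq_2 m_ac)
    ultimately obtain e :: nat and v where h: "v \<in> V" "((x \<otimes> t) [^] (2::nat)) [^] e = b \<otimes> v"
      unfolding N_def by auto
    have "(x \<otimes> t) [^] (2 * e) = b \<otimes> v" using h(2) c by (simp add: nat_pow_pow)
    then show ?thesis unfolding N_def using h(1) x t subringE(6)[OF S] by blast
  qed
  show "primeideal N (R\<lparr>carrier := V\<rparr>)"
    unfolding primeideal_subring_iff[OF S] ideal_subring_iff[OF S]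
  proof (intro conjI ballI impI)
    show "N \<subseteq> V" by (rule NV)
    show "\<one> \<notin> N" using NQ q(3) by blast
    have "\<zero> \<otimes> b \<in> N" using mult[OF subringE(2)[OF S] bN] .
    then show "\<zero> \<in> N" using bc by simp
    fix x y assume xy: "x \<in> N" "y \<in> N"
    have V': "x \<in> V" "y \<in> V" using xy NV by auto
    have "x \<oplus> y = y \<oplus> x" using V' Vc a_comm by blast
    then show "x \<oplus> y \<in> N" using quotient_in_valuation[OF V V'] half xy by metis
  next
    show "r \<otimes> x \<in> N" if "r \<in> V" "x \<in> N" for r x using mult that by blast
  next
    fix x y assume V': "x \<in> V" "y \<in> V" and xy: "x \<otimes> y \<in> N"
    then show "x \<in> N \<or> y \<in> N" using quotient_in_valuation[OF V V'] root comm by metis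
  qed
  fix P assume P: "primeideal P (R\<lparr>carrier := V\<rparr>)" "b \<notin> P"
  note p = primeideal_subringE[OF S P(1)]
  show "P \<subseteq> N"
  proof
    fix x assume x: "x \<in> P"
    then have xV: "x \<in> V" and xc: "x \<in> carrier R" using p(1) Vc by auto
    have "x [^] (1::nat) = x" using xc by simp
    moreover have "\<exists>t\<in>V. x = b \<otimes> t"
      using quotient_in_valuation[OF V xV bV] p(5)[OF _ x] P(2) comm[OF xV] by metis
    ultimately have "\<exists>v\<in>V. x [^] (1::nat) = b \<otimes> v" by simp
    then show "x \<in> N" unfolding N_def using xV by blast
  qed
qed

lemma primeideal_contraction:
  assumes V: "subring V R" and A: "subring A R" "A \<subseteq> V" and Q: "primeideal Q (R\<lparr>carrier := V\<rparr>)"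
  shows "primeideal (Q \<inter> A) (R\<lparr>carrier := A\<rparr>)"
  unfolding primeideal_subring_iff[OF A(1)] ideal_subring_iff[OF A(1)]
  using primeideal_subringE[OF V Q] A(2) subringE(2,6,7)[OF A(1)]
  by (intro conjI ballI impI) (auto, blast+)

text \<open>
  The ring \<open>R1\<close> is generated over \<open>D\<^sub>P\<close> by the inverses of \<open>X\<close>, so it is Noetherian modulo \<open>P\<close>. It is not
  contained in \<open>V\<close>, as elements of \<open>D - P\<close> may be nonunits of \<open>V\<close>; the ring \<open>A = V \<inter> R1\<close> is, it
  determines \<open>V\<close>, and elements of \<open>R1\<close> are quotients of elements of \<open>A\<close> by elements of \<open>D - P\<close>.
  Replacing \<open>Q2\<close> by the radical \<open>N\<close> of \<open>bV\<close> is what makes the nonunits of \<open>B\<close> nilpotent modulo \<open>b\<close>: if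
  \<open>g\<^sup>e = b v\<close> with \<open>v \<in> V\<close>, the equation of \<open>v\<close> over \<open>A\<close> puts a power of \<open>g\<close> into \<open>bB\<close>.
\<close>

theorem no_three_primes_over:
  assumes D: "subring D R" and V: "valuation_ring_of R V" and DV: "D \<subseteq> V"
    and X: "finite X" "X \<subseteq> carrier R" "X \<inter> V = {}"
    and uniq: "\<And>W. valuation_ring_of R W \<Longrightarrow> D \<subseteq> W \<Longrightarrow> X \<inter> W = {} \<Longrightarrow> W = V"
    and Q0: "primeideal Q0 (R\<lparr>carrier := V\<rparr>)" and Q1: "primeideal Q1 (R\<lparr>carrier := V\<rparr>)"
    and Q2: "primeideal Q2 (R\<lparr>carrier := V\<rparr>)" and Q01: "Q0 \<subset> Q1" and Q12: "Q1 \<subset> Q2"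
  shows "Q0 \<inter> D \<noteq> Q2 \<inter> D"
proof
  assume eq: "Q0 \<inter> D = Q2 \<inter> D"
  note S = valuation_ringD(1)[OF V] and val = valuation_ringD(2)[OF V]
  note Vc = subringE(1)[OF S]
  note contr = primeideal_contraction[OF S]
  define P where "P = Q2 \<inter> D"
  have P: "primeideal P (R\<lparr>carrier := D\<rparr>)" unfolding P_def by (rule contr[OF D DV Q2])
  define R0 where "R0 = localisation R D P D"
  note R0 = localisation_subring[OF D P, folded R0_def]
  define Y where "Y = (\<lambda>x. inv x) ` X"
  have Xnz: "x \<in> carrier R" "x \<noteq> \<zero>" "x \<notin> V" if "x \<in> X" for x
    using that X subringE(2)[OF S] by auto
  have YV: "Y \<subseteq> V" unfolding Y_def using Xnz val by blast
  have "noetherian_above (R\<lparr>carrier := R0\<rparr>) P"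
    unfolding R0_def by (rule noetherian_above_localisation[OF D P])
  moreover have "finite Y" "Y \<subseteq> carrier R" "P \<subseteq> R0"
    using X(1) YV Vc R0(2) unfolding Y_def P_def by auto
  ultimately obtain R1 where R1: "subring R1 R" "R0 \<subseteq> R1" "Y \<subseteq> R1"
    "noetherian_above (R\<lparr>carrier := R1\<rparr>) P"
    and least: "\<forall>C. subring C R \<and> R0 \<subseteq> C \<and> Y \<subseteq> C \<longrightarrow> R1 \<subseteq> C"
    using Hilbert_basis_finite[of Y R0 P] R0(1) by blast
  define A where "A = V \<inter> R1"
  have A: "subring A R" "A \<subseteq> V" "A \<subseteq> R1" "D \<subseteq> A" "Y \<subseteq> A"
    unfolding A_def using subring_inter[OF S R1(1)] R0(2) R1(2,3) DV YV by auto
  note Ac = subringE(1)[OF A(1)]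
  have uniqA: "W = V" if W: "valuation_ring_of R W" "A \<subseteq> W"
    and dom: "\<And>x. x \<in> A \<Longrightarrow> x \<noteq> \<zero> \<Longrightarrow> inv x \<notin> V \<Longrightarrow> inv x \<notin> W" for W
  proof (rule uniq[OF W(1)])
    show "D \<subseteq> W" using A(4) W(2) by blast
    have "x \<notin> W" if x: "x \<in> X" for x
    proof -
      note i = nonzero_inv[OF Xnz(1,2)[OF x]]
      have "inv x \<in> A" using A(5) x unfolding Y_def by blast
      then show ?thesis using dom[of "inv x"] i Xnz(3)[OF x] by simp
    qed
    then show "X \<inter> W = {}" by blast
  qed
  obtain a where a: "a \<in> A" "a \<in> Q1" "a \<notin> Q0"
    using incomparability[OF V A(1,2) uniqA Q0 Q1 Q01] by blast
  obtain b where b: "b \<in> A" "b \<in> Q2" "b \<notin> Q1"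
    using incomparability[OF V A(1,2) uniqA Q1 Q2 Q12] by blast
  define N where "N = {x \<in> V. \<exists>e::nat. \<exists>v\<in>V. x [^] e = b \<otimes> v}"
  note N = radical_of_principal_prime[OF V Q2 b(2), folded N_def]
  have Q1N: "Q1 \<subseteq> N" by (rule N(4)[OF Q1 b(3)])
  have pN: "primeideal (N \<inter> A) (R\<lparr>carrier := A\<rparr>)" by (rule contr[OF A(1,2) N(1)])
  define B where "B = localisation R A (N \<inter> A) A"
  note B = localisation_subring[OF A(1) pN, folded B_def]
  note Bc = subringE(1)[OF B(1)]
  have "R1 \<subseteq> B"
  proof -
    have "R0 \<subseteq> B"
    proof
      fix x assume "x \<in> R0"
      then obtain s where s: "x \<in> carrier R" "s \<in> D" "s \<notin> P" "s \<otimes> x \<in> D"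
        unfolding R0_def localisation_def by blast
      then have "s \<in> A - N \<inter> A" using N(2) A(4) unfolding P_def by blast
      then show "x \<in> B" unfolding B_def localisation_def using s A(4) by blast
    qed
    then show ?thesis using least B(1,2) A(5) by blast
  qed
  have PA: "P \<subseteq> R1" using R0(2) R1(2) unfolding P_def by blast
  have noethB: "noetherian_above (R\<lparr>carrier := B\<rparr>) P"
  proof (rule noetherian_above_subring_of_quotients[OF R1(1,4) PA B(1) \<open>R1 \<subseteq> B\<close>])
    fix x assume "x \<in> B"
    then obtain s where s: "s \<in> A - N \<inter> A" "s \<otimes> x \<in> A" unfolding B_def localisation_def by blast
    have "inv s \<in> B" "s \<noteq> \<zero>" using B(3)[OF s(1)] by auto
    moreover have "s \<in> carrier R" using s Ac by blast
    ultimately show "\<exists>s\<in>R1. \<exists>t\<in>B. t \<otimes> s = \<one> \<and> s \<otimes> x \<in> R1"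
      using s A(3) nonzero_inv(3)[of s] by blast
  qed
  have p0: "primeideal (Q0 \<inter> A) (R\<lparr>carrier := A\<rparr>)" and p1: "primeideal (Q1 \<inter> A) (R\<lparr>carrier := A\<rparr>)"
    using contr[OF A(1,2)] Q0 Q1 by blast+
  define p where "p = localisation R A (N \<inter> A) (Q0 \<inter> A)"
  define q where "q = localisation R A (N \<inter> A) (Q1 \<inter> A)"
  have p: "primeideal p (R\<lparr>carrier := B\<rparr>)" "p \<inter> A = Q0 \<inter> A"
    unfolding p_def B_def using primeideal_localisation[OF A(1) pN p0] Q01 Q1N by auto
  have q: "primeideal q (R\<lparr>carrier := B\<rparr>)" "q \<inter> A = Q1 \<inter> A"
    unfolding q_def B_def using primeideal_localisation[OF A(1) pN p1] Q1N by auto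
  interpret B: cring "R\<lparr>carrier := B\<rparr>" by (rule subring_cring[OF B(1)])
  have Pp: "P \<subseteq> p" using p(2) eq A(4) unfolding P_def by blast
  have "q = p"
  proof (rule B.principal_ideal_theorem[OF noetherian_above_mono[OF noethB Pp] p(1) q(1), of b])
    show "p \<subseteq> q" unfolding p_def q_def localisation_def using Q01 by blast
    show "b \<in> carrier (R\<lparr>carrier := B\<rparr>)" using b(1) B(2) by auto
    show "b \<notin> q" using q(2) b by blast
    show "b \<notin> Units (R\<lparr>carrier := B\<rparr>)"
    proof
      assume "b \<in> Units (R\<lparr>carrier := B\<rparr>)"
      then obtain t where t: "t \<in> B" "t \<otimes> b = \<one>" unfolding Units_def by auto
      then obtain s where s: "s \<in> A - N \<inter> A" "s \<otimes> t \<in> A" unfolding B_def localisation_def by blast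
      have c: "s \<in> carrier R" "t \<in> carrier R" "b \<in> carrier R" using s t b Ac Bc by auto
      have "(s \<otimes> t) \<otimes> b \<in> N" using primeideal_subringE(5)[OF S N(1) _ N(3)] s(2) A(2) by blast
      moreover have "(s \<otimes> t) \<otimes> b = s" using c t by (simp add: m_assoc)
      ultimately show False using s(1) by auto
    qed
  next
    \<comment> \<open>A nonunit of \<open>B\<close> is, up to the denominator \<open>s\<close>, an element of \<open>N \<inter> A\<close>.\<close>
    fix g assume gB: "g \<in> carrier (R\<lparr>carrier := B\<rparr>)" and gu: "g \<notin> Units (R\<lparr>carrier := B\<rparr>)"
    then have "g \<in> B" by simp
    then obtain s where s: "s \<in> A - N \<inter> A" "s \<otimes> g \<in> A" and gc: "g \<in> carrier R"
      unfolding B_def localisation_def by blast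
    have sc: "s \<in> carrier R" using s Ac by blast
    have sg: "s \<otimes> g \<in> N"
    proof (rule ccontr)
      assume "s \<otimes> g \<notin> N"
      then have "s \<otimes> g \<in> A - N \<inter> A" using s(2) by blast
      from B(3)[OF this] have i: "s \<otimes> g \<noteq> \<zero>" "inv (s \<otimes> g) \<in> B" by auto
      have "inv (s \<otimes> g) \<otimes> (s \<otimes> g) = \<one>" using nonzero_inv(3)[OF _ i(1)] sc gc by simp
      moreover have "inv (s \<otimes> g) \<in> carrier R" using i(2) Bc by blast
      ultimately have e: "(inv (s \<otimes> g) \<otimes> s) \<otimes> g = \<one>" "g \<otimes> (inv (s \<otimes> g) \<otimes> s) = \<one>"
        using sc gc by (simp_all add: m_ac)
      moreover have "inv (s \<otimes> g) \<otimes> s \<in> B" using i(2) s(1) B(2) subringE(6)[OF B(1)] by blast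
      ultimately have "g \<in> Units (R\<lparr>carrier := B\<rparr>)" unfolding Units_def using \<open>g \<in> B\<close> by auto
      then show False using gu by blast
    qed
    then obtain e :: nat and v where ev: "v \<in> V" "(s \<otimes> g) [^] e = b \<otimes> v" unfolding N_def by blast
    have vc: "v \<in> carrier R" and bc: "b \<in> carrier R" using ev b Ac Vc by auto
    have powA: "x [^] k \<in> A" if "x \<in> A" for x and k :: nat
      by (induction k) (use that subringE[OF A(1)] in auto)
    have bvA: "b \<otimes> v \<in> A" using powA[OF s(2), of e] ev(2) by simp
    have "\<exists>d::nat. \<exists>c\<in>A - N \<inter> A. \<exists>a\<in>A. c \<otimes> (b \<otimes> v) [^] d = b \<otimes> a"
    proof (cases "v = \<zero>")
      case True
      have "\<one> \<in> A - N \<inter> A" using primeideal_subringE(3)[OF A(1) pN] subringE(3)[OF A(1)] by blast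
      moreover have "\<one> \<otimes> (b \<otimes> v) [^] (1::nat) = b \<otimes> \<zero>" using True bc by simp
      ultimately show ?thesis using subringE(2)[OF A(1)] by blast
    next
      case False
      obtain d c where dc: "c \<in> A" "c \<noteq> \<zero>" "inv c \<in> V" "c \<otimes> v [^] (d::nat) \<in> poly_values R A v d"
        using unit_leading_coefficient[OF V A(1,2) uniqA ev(1) False] by blast
      have cc: "c \<in> carrier R" using dc Ac by blast
      have "c \<notin> N"
      proof
        assume "c \<in> N"
        then have "inv c \<otimes> c \<in> N" using primeideal_subringE(5)[OF S N(1) dc(3)] by blast
        then show False using nonzero_inv(3)[OF cc dc(2)] primeideal_subringE(3)[OF S N(1)] by simp
      qed
      moreover obtain a' where a': "a' \<in> A" "b [^] d \<otimes> (c \<otimes> v [^] d) = b \<otimes> a'"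
        using clear_denominator[OF A(1) b(1) vc bvA dc(4)] by blast
      moreover have "c \<otimes> (b \<otimes> v) [^] d = b [^] d \<otimes> (c \<otimes> v [^] d)"
        using bc vc cc by (simp add: nat_pow_distrib m_ac)
      ultimately show ?thesis using dc(1) by auto
    qed
    then obtain d :: nat and c a' where h: "c \<in> A - N \<inter> A" "a' \<in> A" "c \<otimes> (b \<otimes> v) [^] d = b \<otimes> a'"
      by blast
    define k where "k = e * d"
    define t where "t = c \<otimes> s [^] k"
    have spow: "s [^] j \<in> A - N \<inter> A" for j :: nat
    proof (induction j)
      case 0
      then show ?case using primeideal_subringE(3)[OF A(1) pN] subringE(3)[OF A(1)] by auto
    next
      case (Suc j)
      have "s [^] j \<otimes> s \<in> A" using subringE(6)[OF A(1)] Suc s(1) by blast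
      moreover have "s [^] j \<otimes> s \<notin> N \<inter> A"
        using primeideal_subringE(6)[OF A(1) pN, of "s [^] j" s] Suc s(1) by blast
      ultimately show ?case by simp
    qed
    have "t \<in> A - N \<inter> A" unfolding t_def
      using primeideal_subringE(6)[OF A(1) pN, of c "s [^] k"] subringE(6)[OF A(1)] spow h(1) by blast
    from B(3)[OF this] have it: "t \<noteq> \<zero>" "inv t \<in> B" by auto
    have cl: "c \<in> carrier R" "a' \<in> carrier R" "s [^] k \<in> carrier R" "g [^] k \<in> carrier R" "t \<in> carrier R"
      "inv t \<in> carrier R"
      using h Ac sc gc it(2) Bc unfolding t_def by auto
    have "(b \<otimes> v) [^] d = (s \<otimes> g) [^] k" unfolding ev(2)[symmetric] k_def
      using sc gc by (simp add: nat_pow_pow)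
    also have "\<dots> = s [^] k \<otimes> g [^] k" using sc gc by (simp add: nat_pow_distrib)
    finally have "t \<otimes> g [^] k = b \<otimes> a'" using h(3) cl unfolding t_def by (simp add: m_assoc)
    then have "inv t \<otimes> (t \<otimes> g [^] k) = (inv t \<otimes> a') \<otimes> b" using cl bc by (simp add: m_ac)
    moreover have "inv t \<otimes> (t \<otimes> g [^] k) = g [^] k"
      using cl nonzero_inv(3)[OF cl(5) it(1)] by (simp add: m_assoc[symmetric])
    ultimately have "g [^] k = (inv t \<otimes> a') \<otimes> b" by simp
    moreover have "inv t \<otimes> a' \<in> B" using it(2) h(2) B(2) subringE(6)[OF B(1)] by blast
    ultimately have "g [^]\<^bsub>R\<lparr>carrier := B\<rparr>\<^esub> k \<in> PIdl\<^bsub>R\<lparr>carrier := B\<rparr>\<^esub> b"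
      unfolding cgenideal_def nat_pow_consistent[symmetric] by auto
    then show "\<exists>e::nat. g [^]\<^bsub>R\<lparr>carrier := B\<rparr>\<^esub> e \<in> PIdl\<^bsub>R\<lparr>carrier := B\<rparr>\<^esub> b" by blast
  qed
  then show False using p(2) q(2) a by blast
qed

end

section \<open>The fibres of the contraction map and the dimension bound\<close>

lemma three_in_chain:
  assumes "card T = 3" and chain: "\<And>x y. x \<in> T \<Longrightarrow> y \<in> T \<Longrightarrow> x \<subseteq> y \<or> y \<subseteq> x"
  shows "\<exists>x\<in>T. \<exists>y\<in>T. \<exists>z\<in>T. x \<subset> y \<and> y \<subset> z"
proof -
  obtain x y z where T: "T = {x, y, z}" and d: "x \<noteq> y" "x \<noteq> z" "y \<noteq> z"
    using assms(1) card_3_iff[of T] by metis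
  have c: "x \<subset> y \<or> y \<subset> x" "x \<subset> z \<or> z \<subset> x" "y \<subset> z \<or> z \<subset> y"
    using chain[of x y] chain[of x z] chain[of y z] d unfolding T by auto
  show ?thesis unfolding T using c by (elim disjE) auto
qed

context field
begin

text \<open>
  Minimality gives the cover of \<open>Zar(D) - {V}\<close> by the sets \<open>\<U> x\<close> with \<open>x \<notin> V\<close>, compactness makes it finite.
\<close>

lemma finite_separating_set:
  assumes min: "minimal_valuation_overring R D V"
    and comp: "compactin (zariski_topology R D) (Zar R D - {V})"
  shows "\<exists>X. finite X \<and> X \<subseteq> carrier R \<and> X \<inter> V = {} \<and>
    (\<forall>W. valuation_ring_of R W \<longrightarrow> D \<subseteq> W \<longrightarrow> X \<inter> W = {} \<longrightarrow> W = V)"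
proof -
  define \<U> where "\<U> x = {W \<in> Zar R D. {x} \<subseteq> W}" for x
  have opn: "openin (zariski_topology R D) (\<U> x)" if "x \<in> carrier R" for x
    unfolding zariski_topology_def \<U>_def
    by (rule topology_generated_by_Basis) (use that in blast)
  have cover: "Zar R D - {V} \<subseteq> \<Union>(\<U> ` (carrier R - V))"
  proof
    fix W assume W: "W \<in> Zar R D - {V}"
    then have "\<not> W \<subseteq> V" using min unfolding minimal_valuation_overring_def by blast
    then obtain x where x: "x \<in> W" "x \<notin> V" by blast
    have "subring W R" using W valuation_ringD(1) unfolding Zar_def by blast
    then have "x \<in> carrier R" using x subringE(1) by blast
    then show "W \<in> \<Union>(\<U> ` (carrier R - V))" using W x unfolding \<U>_def by blast
  qed
  have "\<forall>U\<in>\<U> ` (carrier R - V). openin (zariski_topology R D) U" using opn by blast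
  then obtain \<F> where F: "finite \<F>" "\<F> \<subseteq> \<U> ` (carrier R - V)" "Zar R D - {V} \<subseteq> \<Union>\<F>"
    using conjunct2[OF comp[unfolded compactin_def], rule_format, of "\<U> ` (carrier R - V)"] cover by blast
  obtain X where X: "X \<subseteq> carrier R - V" "finite X" "\<F> = \<U> ` X"
    using finite_subset_image[OF F(1,2)] by blast
  have "W = V" if W: "valuation_ring_of R W" "D \<subseteq> W" "X \<inter> W = {}" for W
  proof (rule ccontr)
    assume "W \<noteq> V"
    then have "W \<in> \<Union>(\<U> ` X)" using F(3) W(1,2) X(3) unfolding Zar_def by blast
    then show False using W(3) unfolding \<U>_def by blast
  qed
  then show ?thesis using X by blast
qed

text \<open>
  A nonzero \<open>a / b\<close> in \<open>Q\<close> would put its numerator \<open>a\<close> into \<open>Q \<inter> D\<close>.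
\<close>

lemma zero_contraction:
  assumes D: "quotient_field R D" and V: "subring V R" "D \<subseteq> V"
    and Q: "primeideal Q (R\<lparr>carrier := V\<rparr>)" and zero: "Q \<inter> D \<subseteq> {\<zero>}"
  shows "Q = {\<zero>}"
proof -
  note q = primeideal_subringE[OF V(1) Q] and Vc = subringE(1)[OF V(1)]
  have "x = \<zero>" if x: "x \<in> Q" for x
  proof -
    have xc: "x \<in> carrier R" using x q(1) Vc by blast
    then obtain a b where ab: "a \<in> D" "b \<in> D" "b \<noteq> \<zero>" "x = a \<otimes> inv b"
      using D unfolding quotient_field_def by blast
    have c: "a \<in> carrier R" "b \<in> carrier R" using ab V(2) Vc by auto
    have "b \<otimes> x = a \<otimes> (b \<otimes> inv b)"
      unfolding ab(4) using c nonzero_inv(1)[OF c(2) ab(3)] by (simp add: m_lcomm)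
    then have "b \<otimes> x = a" using c nonzero_inv(4)[OF c(2) ab(3)] by simp
    moreover have "b \<otimes> x \<in> Q" using q(5)[OF _ x] ab(2) V(2) by blast
    ultimately have "a = \<zero>" using zero ab(1) by blast
    then show ?thesis using ab(4) c nonzero_inv(1)[OF c(2) ab(3)] by simp
  qed
  then show ?thesis using q(2) by blast
qed

text \<open>
  From a chain \<open>P 0 \<subset> \<dots> \<subset> P n\<close> in \<open>V\<close> the contractions with index congruent to \<open>n\<close> modulo 2 form a strict
  chain in \<open>D\<close>. For even \<open>n\<close> its first member \<open>P 0 \<inter> D\<close> may be replaced by the zero ideal. For odd \<open>n\<close> its first
  member \<open>P 1 \<inter> D\<close> is nonzero by \<open>zero_contraction\<close>, so the zero ideal is added in front. Either way
  the length is half of \<open>n\<close>, rounded up.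
\<close>

lemma krull_dim_le_double:
  assumes D: "quotient_field R D" and V: "subring V R" "D \<subseteq> V"
    and no3: "\<And>Q0 Q1 Q2. primeideal Q0 (R\<lparr>carrier := V\<rparr>) \<Longrightarrow> primeideal Q1 (R\<lparr>carrier := V\<rparr>) \<Longrightarrow>
      primeideal Q2 (R\<lparr>carrier := V\<rparr>) \<Longrightarrow> Q0 \<subset> Q1 \<Longrightarrow> Q1 \<subset> Q2 \<Longrightarrow> Q0 \<inter> D \<noteq> Q2 \<inter> D"
  shows "krull_dim (R\<lparr>carrier := V\<rparr>) \<le> 2 * krull_dim (R\<lparr>carrier := D\<rparr>)"
proof -
  have Ds: "subring D R"
    using D subdomain.axioms(1) subcring.axioms(1) unfolding quotient_field_def by blast
  have "enat n \<le> 2 * krull_dim (R\<lparr>carrier := D\<rparr>)"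
    if P: "\<forall>i\<le>n. P i \<in> Spec (R\<lparr>carrier := V\<rparr>)" "\<forall>i<n. P i \<subset> P (Suc i)" for n P
  proof -
    define r m where "r = n mod 2" and "m = (n + 1) div 2"
    have r: "r \<le> 1" "2 * m = n + r" unfolding r_def m_def by (auto, presburger)
    have pr: "primeideal (P i) (R\<lparr>carrier := V\<rparr>)" if "i \<le> n" for i
      using P(1) that unfolding Spec_def by blast
    have strict: "P i \<subset> P (Suc i)" if "i < n" for i using P(2) that by blast
    \<comment> \<open>With \<open>r = n mod 2\<close> the indices \<open>2 * i - r\<close> have the parity of \<open>n\<close> and end at \<open>2 * m - r = n\<close>.\<close>
    define C where "C i = (if i = 0 then {\<zero>} else P (2 * i - r) \<inter> D)" for i
    have "C i \<in> Spec (R\<lparr>carrier := D\<rparr>)" if "i \<le> m" for i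
    proof (cases "i = 0")
      case True
      have "primeideal {\<zero>} (R\<lparr>carrier := D\<rparr>)"
        unfolding primeideal_subring_iff[OF Ds] ideal_subring_iff[OF Ds]
        using subringE(1,2)[OF Ds] integral by (auto simp: subset_iff)
      then show ?thesis using True unfolding C_def Spec_def by simp
    next
      case False
      have "2 * i - r \<le> n" using that r by linarith
      then show ?thesis
        using False primeideal_contraction[OF V(1) Ds V(2) pr] unfolding C_def Spec_def by simp
    qed
    moreover have "C i \<subset> C (Suc i)" if i: "i < m" for i
    proof (cases "i = 0")
      case True
      have le: "Suc (1 - r) \<le> n" using i True r by linarith
      have s: "2 * Suc 0 - r = Suc (1 - r)" using r(1) by linarith
      have p: "primeideal (P (Suc (1 - r))) (R\<lparr>carrier := V\<rparr>)" "primeideal (P (1 - r)) (R\<lparr>carrier := V\<rparr>)"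
        using pr le by auto
      have "P (Suc (1 - r)) \<noteq> {\<zero>}"
        using strict[of "1 - r"] le primeideal_subringE(2)[OF V(1) p(2)] by auto
      then have "\<not> P (Suc (1 - r)) \<inter> D \<subseteq> {\<zero>}" using zero_contraction[OF D V p(1)] by blast
      moreover have "\<zero> \<in> P (Suc (1 - r)) \<inter> D"
        using primeideal_subringE(2)[OF V(1) p(1)] subringE(2)[OF Ds] by blast
      ultimately show ?thesis unfolding C_def True s[unfolded One_nat_def] using s by auto
    next
      case False
      define k where "k = 2 * i - r"
      have k1: "2 * Suc i - r = Suc (Suc k)" using False r(1) unfolding k_def by arith
      have k2: "Suc (Suc k) \<le> n" using k1 r(2) i by arith
      have "P k \<subset> P (Suc k)" "P (Suc k) \<subset> P (Suc (Suc k))" using strict k2 by auto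
      then have "P k \<inter> D \<noteq> P (Suc (Suc k)) \<inter> D" "P k \<subseteq> P (Suc (Suc k))"
        using no3[OF pr pr pr, of k "Suc k" "Suc (Suc k)"] k2 by auto
      then show ?thesis using False k1 unfolding C_def k_def[symmetric] by auto
    qed
    ultimately have "enat m \<le> krull_dim (R\<lparr>carrier := D\<rparr>)"
      unfolding krull_dim_def by (intro Sup_upper) blast
    then have "2 * enat m \<le> 2 * krull_dim (R\<lparr>carrier := D\<rparr>)" by (intro mult_left_mono) auto
    moreover have "enat n \<le> 2 * enat m" using r(2) by (simp add: numeral_eq_enat)
    ultimately show ?thesis by (rule order_trans[rotated])
  qed
  then show ?thesis unfolding krull_dim_def[of "R\<lparr>carrier := V\<rparr>"] by (intro Sup_least) blast
qed

end

theorem proposition4p3: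
  fixes K :: "('a, 'm) ring_scheme" and D V :: "'a set"
  assumes "quotient_field K D"
    and "minimal_valuation_overring K D V"
    and "compactin (zariski_topology K D) (Zar K D - {V})"
  shows "(\<forall>P\<in>Spec (K\<lparr>carrier := D\<rparr>).
            finite {Q \<in> Spec (K\<lparr>carrier := V\<rparr>). contraction D Q = P} \<and>
            card {Q \<in> Spec (K\<lparr>carrier := V\<rparr>). contraction D Q = P} \<le> 2) \<and>
         krull_dim (K\<lparr>carrier := V\<rparr>) \<le> 2 * krull_dim (K\<lparr>carrier := D\<rparr>)"
proof -
  interpret field K using assms(1) unfolding quotient_field_def by blast
  have D: "subring D K"
    using assms(1) subdomain.axioms(1) subcring.axioms(1) unfolding quotient_field_def by blast
  have V: "valuation_ring_of K V" "D \<subseteq> V"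
    using assms(2) unfolding minimal_valuation_overring_def Zar_def by auto
  obtain X where X: "finite X" "X \<subseteq> carrier K" "X \<inter> V = {}"
    and uniq: "\<forall>W. valuation_ring_of K W \<longrightarrow> D \<subseteq> W \<longrightarrow> X \<inter> W = {} \<longrightarrow> W = V"
    using finite_separating_set[OF assms(2,3)] by blast
  have no3: "Q0 \<inter> D \<noteq> Q2 \<inter> D"
    if "primeideal Q0 (K\<lparr>carrier := V\<rparr>)" "primeideal Q1 (K\<lparr>carrier := V\<rparr>)"
      "primeideal Q2 (K\<lparr>carrier := V\<rparr>)" "Q0 \<subset> Q1" "Q1 \<subset> Q2" for Q0 Q1 Q2
    by (rule no_three_primes_over[OF D V X _ that]) (use uniq in blast)
  have "finite {Q \<in> Spec (K\<lparr>carrier := V\<rparr>). contraction D Q = P} \<and>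
      card {Q \<in> Spec (K\<lparr>carrier := V\<rparr>). contraction D Q = P} \<le> 2" (is "finite ?F \<and> card ?F \<le> 2") for P
  proof (rule ccontr)
    assume "\<not> (finite ?F \<and> card ?F \<le> 2)"
    then have big: "infinite ?F \<or> 3 \<le> card ?F" by auto
    have "\<exists>T. T \<subseteq> ?F \<and> card T = 3"
    proof (cases "finite ?F")
      case True
      then have "3 \<le> card ?F" using big by blast
      then show ?thesis by (rule obtain_subset_with_card_n) blast
    next
      case False
      then show ?thesis using infinite_arbitrarily_large[of ?F 3] by blast
    qed
    then obtain T where T: "T \<subseteq> ?F" "card T = 3" by blast
    have prime: "primeideal Q (K\<lparr>carrier := V\<rparr>)" "Q \<inter> D = P" if "Q \<in> T" for Q
      using T(1) that unfolding Spec_def contraction_def by auto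
    obtain Q0 Q1 Q2 where "Q0 \<in> T" "Q1 \<in> T" "Q2 \<in> T" "Q0 \<subset> Q1" "Q1 \<subset> Q2"
      using three_in_chain[OF T(2)] valuation_primes_chain[OF V(1)] prime(1) by blast
    then show False using no3[OF prime(1) prime(1) prime(1), of Q0 Q1 Q2] prime(2) by simp
  qed
  moreover have "krull_dim (K\<lparr>carrier := V\<rparr>) \<le> 2 * krull_dim (K\<lparr>carrier := D\<rparr>)"
    by (rule krull_dim_le_double[OF assms(1) valuation_ringD(1)[OF V(1)] V(2)]) (use no3 in blast)
  ultimately show ?thesis by blast
qed

end
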